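(* Consider Problem (LQ) as in the context, with $m=n$ and $B=I$, and let $t\ge0$. Assume $A$ is stable with $|e^{As}|\le Me^{-\mu s}$ for all $s\ge0$, for some $M\ge1$, $\mu>0$; $Q-S^\top S\ge0$; and $q(\cdot)\in L^1_{loc}(0,\infty;\mathbb R^n)\setminus L^1(0,\infty;\mathbb R^n)$. Let $q(\cdot)$ admit the polar decomposition $q(s)=|q(s)|\theta(s)$, $s\in[t,\infty)$, with $\theta:[t,\infty)\to\{x\in\mathbb R^n:|x|=1\}$. Suppose $\theta(\cdot)$ is uniformly continuous and $$\liminf_{T\to\infty}\frac1T\int_0^T|q(s)|ds=\infty.$$ Then Problem (LQ) does not have an overtaking optimal control over $\mathscr U_0[t,\infty)$ (at $(t,x)$, for any $x\in\mathbb R^n$).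
   Context: Problem (LQ): state equation $\dot X(s)=AX(s)+Bu(s)$, $s\ge t$, $X(t)=x$, with $A\in\mathbb R^{n\times n}$, $B\in\mathbb R^{n\times m}$; running cost rate $g(s,x,u)=\langle Qx,x\rangle+2\langle Sx,u\rangle+|u|^2+2\langle q(s),x\rangle$, with $Q\in\mathbb R^{n\times n}$ symmetric and $S\in\mathbb R^{m\times n}$. $\mathscr U_0[t,\infty)=L^2(t,\infty;\mathbb R^m)$; $J_T(t,x;u)=\int_t^Tg(s,X(s),u(s))\,ds$ for $T>t$. A control $u^*\in\mathscr U_0[t,\infty)$ is an overtaking optimal control at $(t,x)$ over $\mathscr U_0[t,\infty)$ if $\limsup_{T\to\infty}[J_T(t,x;u^* )-J_T(t,x;u)]\le0$ for all $u\in\mathscr U_0[t,\infty)$. $L^1_{loc}(0,\infty;\mathbb R^n)$ is the set of functions integrable on $[0,T]$ for every $T>0$. *)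

theory Defs
  imports "HOL-Analysis.Analysis"
begin

text \<open>The type class multiplication and power on \<open>real^'n^'n\<close> are componentwise, so powers with
  respect to the matrix product \<open>**\<close> are introduced separately.\<close>

primrec matrix_power :: "real^'n^'n \<Rightarrow> nat \<Rightarrow> real^'n^'n" where
  "matrix_power A 0 = mat 1"
| "matrix_power A (Suc k) = A ** matrix_power A k"

definition matrix_exp :: "real^'n^'n \<Rightarrow> real^'n^'n" where
  "matrix_exp A = (\<Sum>k. (1 / fact k) *\<^sub>R matrix_power A k)"

definition stable_matrix :: "real^'n^'n \<Rightarrow> bool" where
  "stable_matrix A \<longleftrightarrow>
    (\<forall>(z::complex) (v::complex^'n).
       v \<noteq> 0 \<and> (\<chi> i j. complex_of_real (A $ i $ j)) *v v = z *s v \<longrightarrow> Re z < 0)"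

definition pos_semidef :: "real^'n^'n \<Rightarrow> bool" where
  "pos_semidef P \<longleftrightarrow> transpose P = P \<and> (\<forall>x. 0 \<le> x \<bullet> (P *v x))"

text \<open>The control class \<open>\<U>\<^sub>0[t,\<infinity>) = L\<^sup>2(t,\<infinity>; \<real>\<^sup>m)\<close>.\<close>

definition admissible_controls :: "real \<Rightarrow> (real \<Rightarrow> real^'m) set" where
  "admissible_controls t =
    {u. set_borel_measurable lebesgue {t..} u \<and> set_integrable lebesgue {t..} (\<lambda>s. (norm (u s))\<^sup>2)}"

text \<open>Since the control is only square integrable, the state equation is understood in the
  Caratheodory sense, i.e. in integrated form.\<close>

definition is_trajectory ::
  "real^'n^'n \<Rightarrow> real^'m^'n \<Rightarrow> real \<Rightarrow> real^'n \<Rightarrow> (real \<Rightarrow> real^'m) \<Rightarrow> (real \<Rightarrow> real^'n) \<Rightarrow> bool" where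
  "is_trajectory A B t x u X \<longleftrightarrow>
    (\<forall>s\<ge>t. set_integrable lebesgue {t..s} (\<lambda>r. A *v X r + B *v u r) \<and>
           X s = x + (LINT r:{t..s}|lebesgue. A *v X r + B *v u r))"

text \<open>For an admissible control the trajectory exists and its values on \<open>[t,\<infinity>)\<close> are unique; the
  values before time \<open>t\<close> are arbitrary and are never used.\<close>

definition trajectory ::
  "real^'n^'n \<Rightarrow> real^'m^'n \<Rightarrow> real \<Rightarrow> real^'n \<Rightarrow> (real \<Rightarrow> real^'m) \<Rightarrow> real \<Rightarrow> real^'n" where
  "trajectory A B t x u = (SOME X. is_trajectory A B t x u X)"

definition running_cost ::
  "real^'n^'n \<Rightarrow> real^'n^'m \<Rightarrow> (real \<Rightarrow> real^'n) \<Rightarrow> real \<Rightarrow> real^'n \<Rightarrow> real^'m \<Rightarrow> real" where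
  "running_cost Q S q s x u =
    (Q *v x) \<bullet> x + 2 * ((S *v x) \<bullet> u) + (norm u)\<^sup>2 + 2 * (q s \<bullet> x)"

definition cost ::
  "real^'n^'n \<Rightarrow> real^'m^'n \<Rightarrow> real^'n^'n \<Rightarrow> real^'n^'m \<Rightarrow> (real \<Rightarrow> real^'n) \<Rightarrow>
   real \<Rightarrow> real \<Rightarrow> real^'n \<Rightarrow> (real \<Rightarrow> real^'m) \<Rightarrow> real" where
  "cost A B Q S q T t x u =
    (LINT s:{t..T}|lebesgue. running_cost Q S q s (trajectory A B t x u s) (u s))"

definition overtaking_optimal ::
  "real^'n^'n \<Rightarrow> real^'m^'n \<Rightarrow> real^'n^'n \<Rightarrow> real^'n^'m \<Rightarrow> (real \<Rightarrow> real^'n) \<Rightarrow>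
   real \<Rightarrow> real^'n \<Rightarrow> (real \<Rightarrow> real^'m) \<Rightarrow> bool" where
  "overtaking_optimal A B Q S q t x ustar \<longleftrightarrow>
    ustar \<in> admissible_controls t \<and>
    (\<forall>u \<in> admissible_controls t.
       Limsup at_top (\<lambda>T. ereal (cost A B Q S q T t x ustar - cost A B Q S q T t x u)) \<le> 0)"

end

theory Submission
  imports Defs
begin

text \<open>If \<open>u*\<close> were overtaking optimal, it would in particular not lose unboundedly against any
  perturbation \<open>u* + v\<close>. A perturbation against which it does is constructed as follows.

  Since \<open>e\<^bsup>sA\<^esup>\<close> decays exponentially, the trajectory of every square
  integrable control is square integrable on \<open>[t,\<infinity>)\<close> (lemma
  \<open>trajectory_square_integrable\<close>). The quadratic part of the running cost therefore
  contributes only a bounded amount, uniformly in the horizon \<open>T\<close>, and each cost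
  \<open>J\<^sub>T(u)\<close> agrees up to a bounded error with twice the integral of \<open>\<langle>q,
  X\<rangle>\<close> over \<open>[t,T]\<close> (lemma \<open>cost_linear_part\<close>). By linearity of
  the state equation and uniqueness of its solutions, \<open>J\<^sub>T(u*) - J\<^sub>T(u* + v)\<close>
  is then, up to a bounded error, minus twice the integral of \<open>\<langle>q, Y\<rangle>\<close>,
  where \<open>Y\<close> is the trajectory of \<open>v\<close> that starts at \<open>0\<close>.

  It remains to choose \<open>v\<close> such that this integral tends to \<open>-\<infinity>\<close>. As
  \<open>B = I\<close>, any continuously differentiable \<open>Y\<close> that vanishes at time
  \<open>t\<close> is available, provided that \<open>Y' - A Y\<close> is square integrable. So
  \<open>Y\<close> is taken to point against a smoothed version of \<open>\<theta>\<close>, which exists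
  by uniform continuity (lemma \<open>smoothed_direction\<close>), with a length of order
  \<open>1/s\<close>: this is square integrable, but still at least a multiple of \<open>1/T\<close> on
  \<open>[t + 1, T]\<close> (lemma \<open>perturbation_opposing_direction\<close>). Hence minus twice
  the integral of \<open>\<langle>q, Y\<rangle>\<close> dominates a multiple of the average
  \<open>1/T\<close> times the integral of \<open>|q|\<close> over \<open>[0,T]\<close>, up to a bounded
  term (lemma \<open>weighted_integral_ge_average\<close>), and this average tends to infinity by
  hypothesis.\<close>

section \<open>The matrix exponential\<close>

lemma matrix_power_scaleR: "matrix_power (s *\<^sub>R A) k = s ^ k *\<^sub>R matrix_power A k"
  by (induction k)
    (simp_all add: vec_eq_iff matrix_matrix_mult_def sum_distrib_left mult_ac)

lemma abs_matrix_power_le: "\<bar>matrix_power A k $ i $ j\<bar> \<le> onorm ((*v) A) ^ k"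
proof -
  have "onorm ((*v) (matrix_power A k)) \<le> onorm ((*v) A) ^ k"
  proof (induction k)
    case 0
    then show ?case by (simp add: onorm_id_le)
  next
    case (Suc k)
    have "onorm ((*v) (matrix_power A (Suc k))) = onorm ((*v) A \<circ> (*v) (matrix_power A k))"
      by (simp add: o_def matrix_vector_mul_assoc)
    also have "\<dots> \<le> onorm ((*v) A) * onorm ((*v) (matrix_power A k))"
      by (rule onorm_compose) auto
    also have "\<dots> \<le> onorm ((*v) A) * onorm ((*v) A) ^ k"
      by (intro mult_left_mono Suc.IH onorm_pos_le) auto
    finally show ?case by simp
  qed
  then show ?thesis
    using matrix_component_le_onorm[of "matrix_power A k" i j] by linarith
qed

lemma summable_matrix_exp_entry:
  "summable (\<lambda>k. matrix_power A k $ i $ j / fact k * s ^ k)"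
proof (rule summable_comparison_test)
  show "\<exists>N. \<forall>k\<ge>N. norm (matrix_power A k $ i $ j / fact k * s ^ k)
          \<le> inverse (fact k) * (onorm ((*v) A) * \<bar>s\<bar>) ^ k"
    using mult_right_mono[OF abs_matrix_power_le[of A _ i j], of "\<bar>s\<bar> ^ k / fact k" k for k]
    by (auto simp: abs_mult power_abs power_mult_distrib field_simps)
  show "summable (\<lambda>k. inverse (fact k) * (onorm ((*v) A) * \<bar>s\<bar>) ^ k)"
    by (rule summable_exp)
qed

lemma matrix_exp_entry:
  "matrix_exp (s *\<^sub>R A) $ i $ j = (\<Sum>k. matrix_power A k $ i $ j / fact k * s ^ k)"
proof -
  let ?E = "\<chi> i j. \<Sum>k. matrix_power A k $ i $ j / fact k * s ^ k"
  have "(\<lambda>k. (1 / fact k) *\<^sub>R matrix_power (s *\<^sub>R A) k) sums ?E"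
    unfolding sums_def
  proof (intro vec_tendstoI)
    fix i j
    show "(\<lambda>n. (\<Sum>k<n. (1 / fact k) *\<^sub>R matrix_power (s *\<^sub>R A) k) $ i $ j) \<longlonglongrightarrow> ?E $ i $ j"
      using summable_sums[OF summable_matrix_exp_entry[of A i j s]]
      by (simp add: sums_def matrix_power_scaleR mult_ac)
  qed
  then show ?thesis
    by (simp add: matrix_exp_def sums_iff)
qed

lemma matrix_exp_zero: "matrix_exp (0 *\<^sub>R A) = mat 1"
  unfolding vec_eq_iff matrix_exp_entry
  by (simp add: powser_zero del: times_divide_eq_left)

text \<open>Each entry of \<open>e\<^bsup>sA\<^esup>\<close> is an everywhere convergent real power series in
  \<open>s\<close>, so termwise differentiation of real power series gives \<open>E' = A E\<close> entry
  by entry.\<close>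
lemma matrix_exp_entry_derivative:
  "((\<lambda>s. matrix_exp (s *\<^sub>R A) $ i $ j) has_real_derivative
     (A ** matrix_exp (s *\<^sub>R A)) $ i $ j) (at s)"
proof -
  have "((\<lambda>s. \<Sum>k. matrix_power A k $ i $ j / fact k * s ^ k) has_real_derivative
      (\<Sum>k. diffs (\<lambda>k. matrix_power A k $ i $ j / fact k) k * s ^ k)) (at s)"
    by (rule termdiffs_strong_converges_everywhere) (rule summable_matrix_exp_entry)
  moreover have "diffs (\<lambda>k. matrix_power A k $ i $ j / fact k) k * s ^ k
      = (\<Sum>l\<in>UNIV. A $ i $ l * (matrix_power A k $ l $ j / fact k * s ^ k))" for k
  proof -
    have "diffs (\<lambda>k. matrix_power A k $ i $ j / fact k) k = matrix_power A (Suc k) $ i $ j / fact k"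
      by (simp add: diffs_def field_simps del: matrix_power.simps of_nat_Suc)
    then show ?thesis
      by (simp add: matrix_matrix_mult_def sum_distrib_right sum_divide_distrib sum_distrib_left mult_ac)
  qed
  moreover have "(\<Sum>k. \<Sum>l\<in>UNIV. A $ i $ l * (matrix_power A k $ l $ j / fact k * s ^ k))
      = (A ** matrix_exp (s *\<^sub>R A)) $ i $ j"
    by (subst suminf_sum) (simp_all add: matrix_matrix_mult_def matrix_exp_entry summable_mult suminf_mult
        summable_matrix_exp_entry del: times_divide_eq_left)
  ultimately show ?thesis
    by (simp only: matrix_exp_entry)
qed

lemma matrix_exp_derivative:
  "((\<lambda>s. matrix_exp (s *\<^sub>R A) *v y) has_vector_derivative A *v (matrix_exp (s *\<^sub>R A) *v y)) (at s)"
proof -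
  have "((\<lambda>s. (matrix_exp (s *\<^sub>R A) *v y) $ i) has_real_derivative
      ((A ** matrix_exp (s *\<^sub>R A)) *v y) $ i) (at s)" for i
    unfolding matrix_vector_mult_def
    by (auto intro!: derivative_eq_intros matrix_exp_entry_derivative)
  then have "((\<lambda>s. (matrix_exp (s *\<^sub>R A) *v y) \<bullet> axis i 1) has_derivative
      (\<lambda>h. (h *\<^sub>R (A *v (matrix_exp (s *\<^sub>R A) *v y))) \<bullet> axis i 1)) (at s)" for i
    unfolding has_real_derivative_iff_has_vector_derivative has_vector_derivative_def
    by (simp only: inner_axis matrix_vector_mul_assoc vector_scaleR_component) simp
  then show ?thesis
    unfolding has_vector_derivative_def
    by (subst has_derivative_componentwise_within) (simp add: Basis_vec_def)
qed

lemma continuous_on_matrix_exp: "continuous_on S (\<lambda>s. matrix_exp (s *\<^sub>R A))"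
proof -
  have "continuous_on S (\<lambda>s. matrix_exp (s *\<^sub>R A) $ i $ j)" for i j
    using matrix_exp_entry_derivative[of A i j]
    by (intro continuous_at_imp_continuous_on ballI) (auto intro: DERIV_isCont)
  then have "continuous_on S (\<lambda>s. \<chi> i j. matrix_exp (s *\<^sub>R A) $ i $ j)"
    by (intro continuous_on_vec_lambda)
  then show ?thesis by (simp add: vec_lambda_eta)
qed

lemma bounded_bilinear_matrix_vector_mult:
  "bounded_bilinear ((*v) :: real^'n^'m \<Rightarrow> real^'n \<Rightarrow> real^'m)"
  by (simp add: bilinear_conv_bounded_bilinear[symmetric] bilinear_def linear_iff
      matrix_vector_mult_add_rdistrib matrix_vector_right_distrib scaleR_matrix_vector_assoc
      matrix_vector_mult_scaleR)

lemma matrix_exp_bound_on_Icc: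
  fixes A :: "real^'n^'n"
  obtains C where "0 \<le> C" "\<And>s y. s \<in> {0..b} \<Longrightarrow> norm (matrix_exp (s *\<^sub>R A) *v y) \<le> C * norm y"
proof -
  have "bounded ((\<lambda>s. matrix_exp (s *\<^sub>R A)) ` {0..b})"
    by (intro compact_imp_bounded compact_continuous_image continuous_on_matrix_exp compact_Icc)
  then obtain C where C: "\<And>s. s \<in> {0..b} \<Longrightarrow> norm (matrix_exp (s *\<^sub>R A)) \<le> C"
    unfolding bounded_iff by blast
  obtain K where K: "0 \<le> K" "\<And>(P :: real^'n^'n) y. norm (P *v y) \<le> norm P * norm y * K"
    using bounded_bilinear.nonneg_bounded[OF bounded_bilinear_matrix_vector_mult] by blast
  have "norm (matrix_exp (s *\<^sub>R A) *v y)
      \<le> (\<bar>C\<bar> * K) * norm y" if "s \<in> {0..b}" for s and y :: "real^'n"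
  proof -
    have "norm (matrix_exp (s *\<^sub>R A)) * (norm y * K) \<le> \<bar>C\<bar> * (norm y * K)"
      using C[OF that] K(1) by (intro mult_right_mono) auto
    then show ?thesis using K(2)[of "matrix_exp (s *\<^sub>R A)" y] by (simp add: mult_ac)
  qed
  then show ?thesis using that[of "\<bar>C\<bar> * K"] K(1) by simp
qed

section \<open>Integration on the real line\<close>

text \<open>The controls and \<open>q\<close> are Lebesgue rather than Borel measurable, so Fubini's theorem is used
  on the product of two completed measures. Continuous functions of the two coordinates are measurable
  there as well, which is all that the kernels below require.\<close>
lemma sigma_finite_lebesgue: "sigma_finite_measure (lebesgue :: 'a::euclidean_space measure)"
proof
  obtain \<A> :: "'a set set" where "countable \<A>" "\<A> \<subseteq> sets lborel" "\<Union>\<A> = space lborel"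
      "\<forall>a\<in>\<A>. emeasure lborel a \<noteq> \<infinity>"
    using lborel.sigma_finite_countable by auto
  then show "\<exists>\<A>::'a set set. countable \<A> \<and> \<A> \<subseteq> sets lebesgue \<and> \<Union>\<A> = space lebesgue \<and>
      (\<forall>a\<in>\<A>. emeasure lebesgue a \<noteq> \<infinity>)"
    by (intro exI[of _ \<A>]) (auto simp: subset_iff)
qed

interpretation lebesgue_pair: pair_sigma_finite "lebesgue :: real measure" "lebesgue :: real measure"
  by (intro pair_sigma_finite.intro sigma_finite_lebesgue)

lemma borel_measurable_matrix_vector_mult [measurable (raw)]:
  fixes F :: "'a \<Rightarrow> real^'n^'m"
  assumes "F \<in> borel_measurable M" "g \<in> borel_measurable M"
  shows "(\<lambda>z. F z *v g z) \<in> borel_measurable M"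
proof (rule borel_measurable_continuous_Pair[OF assms])
  show "continuous_on UNIV (\<lambda>x::(real^'n^'m) \<times> _. fst x *v snd x)"
    unfolding matrix_vector_mult_def by (intro continuous_intros)
qed

lemma integrable_pair_mult:
  fixes f g :: "real \<Rightarrow> real"
  assumes "integrable lebesgue f" "integrable lebesgue g"
  shows "integrable (lebesgue \<Otimes>\<^sub>M lebesgue) (\<lambda>z. f (fst z) * g (snd z))"
proof (rule lebesgue_pair.Fubini_integrable)
  have [measurable]: "f \<in> borel_measurable lebesgue" "g \<in> borel_measurable lebesgue"
    using assms by auto
  show "(\<lambda>z. f (fst z) * g (snd z)) \<in> borel_measurable (lebesgue \<Otimes>\<^sub>M lebesgue)"
    by measurable
  show "integrable lebesgue (\<lambda>x. LINT y|lebesgue. norm (f (fst (x, y)) * g (snd (x, y))))"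
    using assms by (simp add: abs_mult)
  show "AE x in lebesgue. integrable lebesgue (\<lambda>y. f (fst (x, y)) * g (snd (x, y)))"
    using assms by simp
qed

lemma set_borel_measurable_continuous_lebesgue:
  fixes f :: "real \<Rightarrow> 'a::euclidean_space"
  assumes "continuous_on S f" "S \<in> sets borel"
  shows "set_borel_measurable lebesgue S f"
  using borel_measurable_continuous_on_indicator[OF assms(2,1)]
  unfolding set_borel_measurable_def by (auto intro: measurable_completion)

lemma set_integral_FTC:
  fixes F :: "real \<Rightarrow> 'a::euclidean_space"
  assumes "a \<le> b"
    and "\<And>s. s \<in> {a..b} \<Longrightarrow> (F has_vector_derivative f s) (at s within {a..b})"
    and "continuous_on {a..b} f"
  shows "set_integrable lebesgue {a..b} f" "(LINT s:{a..b}|lebesgue. f s) = F b - F a"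
proof -
  show "set_integrable lebesgue {a..b} f"
    by (rule absolutely_integrable_continuous_real) fact
  then show "(LINT s:{a..b}|lebesgue. f s) = F b - F a"
    using fundamental_theorem_of_calculus[OF assms(1,2)]
    by (simp add: set_lebesgue_integral_eq_integral integral_unique)
qed

lemma continuous_on_indefinite_integral:
  fixes f :: "real \<Rightarrow> 'a::euclidean_space"
  assumes f: "\<And>s. t \<le> s \<Longrightarrow> set_integrable lebesgue {t..s} f"
  shows "continuous_on {t..} (\<lambda>s. LINT r:{t..s}|lebesgue. f r)"
proof -
  have eq: "(LINT r:{t..s}|lebesgue. f r) = integral {t..s} f" if "t \<le> s" for s
    by (rule set_lebesgue_integral_eq_integral(2)) (use f that in blast)
  have "continuous (at s within {t..}) (\<lambda>s. LINT r:{t..s}|lebesgue. f r)" if "s \<in> {t..}" for s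
  proof -
    have "continuous_on {t..s+1} (\<lambda>s. integral {t..s} f)"
      using f[of "s + 1"] that
      by (intro indefinite_integral_continuous_1 set_lebesgue_integral_eq_integral(1)) auto
    then have "continuous_on {t..s+1} (\<lambda>s. LINT r:{t..s}|lebesgue. f r)"
      by (rule continuous_on_eq) (use eq in auto)
    then have "continuous (at s within {t..s+1}) (\<lambda>s. LINT r:{t..s}|lebesgue. f r)"
      using that by (auto simp: continuous_on_eq_continuous_within)
    moreover have "at s within {t..s+1} = at s within {t..}"
      by (rule at_within_nhd[of _ "{..<s+1}"]) auto
    ultimately show ?thesis by (simp add: continuous_within)
  qed
  then show ?thesis by (simp add: continuous_on_eq_continuous_within)
qed

lemma set_integrable_exp_kernel:
  assumes "0 < (\<mu> :: real)"
  shows "set_integrable lebesgue {r..} (\<lambda>s. exp (- \<mu> * (s - r)))"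
    and "(LINT s:{r..}|lebesgue. exp (- \<mu> * (s - r))) = 1 / \<mu>"
proof -
  have "((\<lambda>s. exp (\<mu> * r) * exp (- \<mu> * s)) has_integral exp (\<mu> * r) * (exp (- \<mu> * r) / \<mu>)) {r..}"
    by (intro has_integral_mult_right has_integral_exp_minus_to_infinity assms)
  then have *: "((\<lambda>s. exp (- \<mu> * (s - r))) has_integral 1 / \<mu>) {r..}"
    by (simp add: exp_add[symmetric] algebra_simps flip: exp_add)
  then show "set_integrable lebesgue {r..} (\<lambda>s. exp (- \<mu> * (s - r)))"
    by (intro nonnegative_absolutely_integrable_1) auto
  from set_lebesgue_integral_eq_integral(2)[OF this] *
  show "(LINT s:{r..}|lebesgue. exp (- \<mu> * (s - r))) = 1 / \<mu>"
    by (simp add: integral_unique)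
qed

text \<open>Jensen's inequality for the square with a weight of total mass at most \<open>m\<close>, obtained by
  expanding the integral of \<open>w (g - c/m)\<^sup>2 \<ge> 0\<close> with \<open>c\<close> the
  integral of \<open>w g\<close>.\<close>
lemma weighted_jensen:
  fixes w g :: "real \<Rightarrow> real"
  assumes "integrable M w" "integrable M (\<lambda>r. w r * g r)" "integrable M (\<lambda>r. w r * (g r)\<^sup>2)"
    and "\<And>r. 0 \<le> w r" "(LINT r|M. w r) \<le> m" "0 < m"
  shows "(LINT r|M. w r * g r)\<^sup>2 \<le> m * (LINT r|M. w r * (g r)\<^sup>2)"
proof -
  define c where "c = (LINT r|M. w r * g r)"
  have "0 \<le> (LINT r|M. w r * (g r - c / m)\<^sup>2)"
    using assms(4) by simp
  also have "\<dots> = (LINT r|M. w r * (g r)\<^sup>2 - (2 * (c / m)) * (w r * g r) + (c / m)\<^sup>2 * w r)"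
    by (intro Bochner_Integration.integral_cong refl) (simp add: power2_eq_square algebra_simps)
  also have "\<dots> = (LINT r|M. w r * (g r)\<^sup>2) - (2 * (c / m)) * c + (c / m)\<^sup>2 * (LINT r|M. w r)"
    using assms(1-3) by (simp add: c_def)
  also have "\<dots> \<le> (LINT r|M. w r * (g r)\<^sup>2) - (2 * (c / m)) * c + (c / m)\<^sup>2 * m"
    using assms(5) by (simp add: mult_left_mono)
  also have "\<dots> = (LINT r|M. w r * (g r)\<^sup>2) - c\<^sup>2 / m"
    using assms(6) by (simp add: power2_eq_square field_simps)
  finally show ?thesis
    using assms(6) by (simp add: c_def field_simps)
qed

section \<open>Trajectories\<close>

text \<open>Inserting the formula for \<open>X\<close> into the integrated state equation produces the double
  integral of \<open>A E(\<tau> - r) f(r)\<close> over the triangle \<open>t \<le> r \<le> \<tau> \<le>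
  T\<close>. Integrating over \<open>\<tau>\<close> first, the fundamental theorem of calculus turns the
  inner integral into \<open>E(T - r) f(r) - f(r)\<close>, which is what the state equation asks for.
  Fubini's theorem replaces a product rule for the merely absolutely continuous trajectory.\<close>
lemma variation_of_constants:
  fixes A :: "real^'n^'n" and f :: "real \<Rightarrow> real^'n"
  assumes f: "\<And>s. t \<le> s \<Longrightarrow> set_integrable lebesgue {t..s} f"
    and X: "\<And>s. X s = matrix_exp ((s - t) *\<^sub>R A) *v x
                  + (LINT r:{t..s}|lebesgue. matrix_exp ((s - r) *\<^sub>R A) *v f r)"
    and T: "t \<le> T"
  shows "set_integrable lebesgue {t..T} (\<lambda>s. A *v X s + f s)"
    and "X T = x + (LINT s:{t..T}|lebesgue. A *v X s + f s)"
proof -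
  let ?E = "\<lambda>s. matrix_exp (s *\<^sub>R A)"
  define g where "g r = indicator {t..T} r *\<^sub>R f r" for r
  define W where "W s = (LINT r:{t..s}|lebesgue. ?E (s - r) *v f r)" for s
  \<comment> \<open>the integrand on the triangle \<open>t \<le> r \<le> \<tau> \<le> T\<close>, where \<open>g\<close> supplies the condition \<open>t \<le> r\<close>\<close>
  define K where "K \<tau> r = indicator {(\<tau>, r). r \<le> \<tau>} (\<tau>, r) *\<^sub>R indicator {t..T} \<tau> *\<^sub>R (A *v (?E (\<tau> - r) *v g r))" for \<tau> r
  have g_int: "integrable lebesgue g"
    using f[OF T] unfolding g_def set_integrable_def .
  have g_meas [measurable]: "g \<in> borel_measurable lebesgue"
    using g_int by auto
  have [measurable]: "?E \<in> borel_measurable borel"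
    by (intro borel_measurable_continuous_onI continuous_on_matrix_exp)
  have id_meas [measurable]: "(\<lambda>x::real. x) \<in> lebesgue \<rightarrow>\<^sub>M borel"
    by (rule measurable_completion) simp
  obtain C where C: "0 \<le> C" "\<And>s y. s \<in> {0..T-t} \<Longrightarrow> norm (?E s *v y) \<le> C * norm y"
    using matrix_exp_bound_on_Icc[of "T - t" A] by blast
  let ?a = "onorm ((*v) A)"
  have a: "norm (A *v y) \<le> ?a * norm y" "0 \<le> ?a" for y
    by (auto intro: onorm onorm_pos_le)

  have sect: "set_integrable lebesgue {t..s} (\<lambda>r. ?E (s - r) *v f r)" if s: "s \<in> {t..T}" for s
    unfolding set_integrable_def
  proof (rule Bochner_Integration.integrable_bound)
    show "integrable lebesgue (\<lambda>r. C * norm (g r))"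
      using g_int by simp
    have "(\<lambda>r. indicator {t..s} r *\<^sub>R (?E (s - r) *v f r))
        = (\<lambda>r. indicator {t..s} r *\<^sub>R (?E (s - r) *v g r))"
      using s by (auto simp: g_def indicator_def fun_eq_iff)
    moreover have "(\<lambda>r. indicator {t..s} r *\<^sub>R (?E (s - r) *v g r)) \<in> borel_measurable lebesgue"
      by measurable
    ultimately show "(\<lambda>r. indicator {t..s} r *\<^sub>R (?E (s - r) *v f r)) \<in> borel_measurable lebesgue"
      by simp
    show "AE r in lebesgue. norm (indicator {t..s} r *\<^sub>R (?E (s - r) *v f r)) \<le> norm (C * norm (g r))"
      using s C by (auto simp: g_def indicator_def)
  qed

  have ind_int: "integrable lebesgue (indicator {t..T} :: real \<Rightarrow> real)"
    using absolutely_integrable_continuous_real[OF continuous_on_const[of "{t..T}" "1::real"]]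
    by (simp add: set_integrable_def)
  have K_int: "integrable (lebesgue \<Otimes>\<^sub>M lebesgue) (case_prod K)"
  proof (rule Bochner_Integration.integrable_bound)
    show "integrable (lebesgue \<Otimes>\<^sub>M lebesgue) (\<lambda>z. (?a * C * indicator {t..T} (fst z)) * norm (g (snd z)))"
      by (rule integrable_pair_mult[where f="\<lambda>s. ?a * C * indicator {t..T} s" and g="\<lambda>r. norm (g r)"])
        (use g_int ind_int in auto)
    have "(\<lambda>z. indicator {t..T} (fst z) *\<^sub>R (if snd z
        \<le> fst z then A *v (?E (fst z - snd z) *v g (snd z)) else 0))
       \<in> borel_measurable (lebesgue \<Otimes>\<^sub>M lebesgue)"
      by measurable
    also have "(\<lambda>z. indicator {t..T} (fst z) *\<^sub>R (if snd z
        \<le> fst z then A *v (?E (fst z - snd z) *v g (snd z)) else 0)) = case_prod K"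
      by (auto simp: K_def fun_eq_iff indicator_def)
    finally show "case_prod K \<in> borel_measurable (lebesgue \<Otimes>\<^sub>M lebesgue)" .
    have "norm (K \<tau> r) \<le> (?a * C * indicator {t..T} \<tau>) * norm (g r)" for \<tau> r
    proof (cases "r \<in> {t..\<tau>} \<and> \<tau> \<in> {t..T}")
      case True
      then have "norm (A *v (?E (\<tau> - r) *v g r)) \<le> ?a * (C * norm (g r))"
        by (intro order.trans[OF a(1)] mult_left_mono C a) auto
      then show ?thesis using True by (simp add: K_def)
    next
      case False
      then have "K \<tau> r = 0" by (auto simp: K_def g_def indicator_def)
      then show ?thesis using C(1) a(2) by simp
    qed
    moreover have "0 \<le> (?a * C * indicator {t..T} \<tau>) * norm (g r)" for \<tau> r
      using C(1) a(2) by simp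
    ultimately show "AE z in lebesgue \<Otimes>\<^sub>M lebesgue. norm (case_prod K z)
        \<le> norm ((?a * C * indicator {t..T} (fst z)) * norm (g (snd z)))"
      by (auto simp: abs_of_nonneg split: prod.splits simp del: norm_mult)
  qed

  have inner_r: "(LINT r|lebesgue. K \<tau> r) = indicator {t..T} \<tau> *\<^sub>R (A *v W \<tau>)" for \<tau>
  proof (cases "\<tau> \<in> {t..T}")
    case True
    have "K \<tau> r = indicator {t..\<tau>} r *\<^sub>R (A *v (?E (\<tau> - r) *v f r))" for r
      using True by (auto simp: K_def g_def indicator_def)
    then have "(LINT r|lebesgue. K \<tau> r) = (LINT r|lebesgue. A *v (indicator {t..\<tau>} r *\<^sub>R (?E (\<tau> - r) *v f r)))"
      by (simp add: matrix_vector_mult_scaleR)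
    also have "\<dots> = A *v W \<tau>"
      unfolding W_def set_lebesgue_integral_def
      using sect[OF True]
      by (intro integral_bounded_linear) (auto simp: set_integrable_def)
    finally show ?thesis using True by simp
  qed (simp add: K_def)

  have exp_ftc: "set_integrable lebesgue {r..T} (\<lambda>\<tau>. A *v (?E (\<tau> - r) *v y))"
      "(LINT \<tau>:{r..T}|lebesgue. A *v (?E (\<tau> - r) *v y)) = ?E (T - r) *v y - y"
    if "r \<le> T" for r y
  proof -
    have d: "((\<lambda>\<tau>. ?E (\<tau> - r) *v y)
        has_vector_derivative A *v (?E (\<tau> - r) *v y)) (at \<tau> within {r..T})" for \<tau>
    proof -
      have "((\<lambda>\<tau>. \<tau> - r) has_real_derivative 1) (at \<tau> within {r..T})"
        by (auto intro!: derivative_eq_intros)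
      then show ?thesis
        using vector_diff_chain_within[OF _ has_vector_derivative_at_within[OF matrix_exp_derivative]]
        by (force simp: has_real_derivative_iff_has_vector_derivative o_def)
    qed
    then have "continuous_on {r..T} (\<lambda>\<tau>. ?E (\<tau> - r) *v y)"
      by (meson continuous_on_vector_derivative)
    then have c: "continuous_on {r..T} (\<lambda>\<tau>. A *v (?E (\<tau> - r) *v y))"
      by (rule continuous_on_compose2[OF matrix_vector_mult_linear_continuous_on, where t=UNIV]) auto
    show "set_integrable lebesgue {r..T} (\<lambda>\<tau>. A *v (?E (\<tau> - r) *v y))"
      by (rule set_integral_FTC(1)[OF that d c])
    show "(LINT \<tau>:{r..T}|lebesgue. A *v (?E (\<tau> - r) *v y)) = ?E (T - r) *v y - y"
      using set_integral_FTC(2)[OF that d c] matrix_exp_zero[of A] by simp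
  qed

  have inner_\<tau>: "(LINT \<tau>|lebesgue. K \<tau> r) = indicator {t..T} r *\<^sub>R (?E (T - r) *v f r - f r)" for r
  proof (cases "r \<in> {t..T}")
    case True
    then have "K \<tau> r = indicator {r..T} \<tau> *\<^sub>R (A *v (?E (\<tau> - r) *v f r))" for \<tau>
      by (auto simp: K_def g_def indicator_def)
    then show ?thesis
      using exp_ftc(2)[of r "f r"] True by (simp add: set_lebesgue_integral_def)
  qed (simp add: K_def g_def)

  have W_int: "set_integrable lebesgue {t..T} (\<lambda>s. A *v W s)"
    using lebesgue_pair.integrable_fst[OF K_int] by (simp add: inner_r set_integrable_def)
  have "(LINT s:{t..T}|lebesgue. A *v W s) = (LINT r:{t..T}|lebesgue. ?E (T - r) *v f r - f r)"
    using lebesgue_pair.Fubini_integral[OF K_int] by (simp add: inner_r inner_\<tau> set_lebesgue_integral_def)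
  also have "\<dots> = W T - (LINT r:{t..T}|lebesgue. f r)"
    using set_integral_diff(2)[OF sect f] T by (simp add: W_def)
  finally have W_eq: "(LINT s:{t..T}|lebesgue. A *v W s) = W T - (LINT r:{t..T}|lebesgue. f r)" .

  have split: "A *v X s + f s = A *v (?E (s - t) *v x) + A *v W s + f s" for s
    by (simp add: X W_def matrix_vector_right_distrib)
  note i1 = set_integral_add[OF exp_ftc(1)[OF T] W_int]
  note i2 = set_integral_add[OF i1(1) f[OF T]]
  show "set_integrable lebesgue {t..T} (\<lambda>s. A *v X s + f s)"
    unfolding split by (rule i2(1))
  show "X T = x + (LINT s:{t..T}|lebesgue. A *v X s + f s)"
    unfolding split i2(2) i1(2) exp_ftc(2)[OF T] W_eq
    by (simp add: X W_def)
qed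

lemma trajectory_continuous:
  assumes "is_trajectory A B t x u X"
  shows "continuous_on {t..} X"
proof -
  have "continuous_on {t..} (\<lambda>s. x + (LINT r:{t..s}|lebesgue. A *v X r + B *v u r))"
    using assms by (intro continuous_intros continuous_on_indefinite_integral) (auto simp: is_trajectory_def)
  then show ?thesis
    by (rule continuous_on_eq) (use assms in \<open>auto simp: is_trajectory_def\<close>)
qed

lemma is_trajectory_add:
  assumes "is_trajectory A B t x u X" "is_trajectory A B t y v Y"
  shows "is_trajectory A B t (x + y) (\<lambda>s. u s + v s) (\<lambda>s. X s + Y s)"
  unfolding is_trajectory_def
proof (intro allI impI)
  fix s assume "t \<le> s"
  then have X: "set_integrable lebesgue {t..s} (\<lambda>r. A *v X r + B *v u r)"
      "X s = x + (LINT r:{t..s}|lebesgue. A *v X r + B *v u r)"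
    and Y: "set_integrable lebesgue {t..s} (\<lambda>r. A *v Y r + B *v v r)"
      "Y s = y + (LINT r:{t..s}|lebesgue. A *v Y r + B *v v r)"
    using assms by (auto simp: is_trajectory_def)
  have "A *v (X r + Y r) + B *v (u r + v r) = (A *v X r + B *v u r) + (A *v Y r + B *v v r)" for r
    by (simp add: matrix_vector_right_distrib)
  then show "set_integrable lebesgue {t..s} (\<lambda>r. A *v (X r + Y r) + B *v (u r + v r)) \<and>
      X s + Y s = x + y + (LINT r:{t..s}|lebesgue. A *v (X r + Y r) + B *v (u r + v r))"
    using set_integral_add[OF X(1) Y(1)] X(2) Y(2) by simp
qed

text \<open>Gronwall's argument: the energy \<open>|D|\<^sup>2\<close> grows at most at the rate \<open>2
  |A|\<close>, so that \<open>e\<^bsup>-2|A|s\<^esup> |D|\<^sup>2\<close> is non-negative,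
  non-increasing and zero at time \<open>t\<close>.\<close>
lemma linear_ode_zero:
  fixes D :: "real \<Rightarrow> real^'n"
  assumes cont: "continuous_on {t..} D"
    and D: "\<And>s. t \<le> s \<Longrightarrow> D s = (LINT r:{t..s}|lebesgue. A *v D r)"
    and s: "t \<le> s"
  shows "D s = 0"
proof -
  define k where "k = onorm ((*v) A)"
  define F where "F r = exp (- 2 * k * r) * (D r \<bullet> D r)" for r
  have cAD: "continuous_on {t..s} (\<lambda>r. A *v D r)"
    by (rule continuous_on_compose2[OF matrix_vector_mult_linear_continuous_on, where t=UNIV])
      (auto intro: continuous_on_subset[OF cont])
  have cD: "continuous_on {t..s} D"
    by (rule continuous_on_subset[OF cont]) auto
  have D_int: "D r = integral {t..r} (\<lambda>r. A *v D r)" if "r \<in> {t..s}" for r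
    using that D[of r] continuous_on_subset[OF cAD, of "{t..r}"]
    by (auto simp: set_lebesgue_integral_eq_integral(2) absolutely_integrable_continuous_real)
  have D': "(D has_vector_derivative A *v D r) (at r)" if "t < r" "r < s" for r
  proof -
    have "(D has_vector_derivative A *v D r) (at r within {t..s})"
      using integral_has_vector_derivative[OF cAD, of r] that D_int
      by (auto intro: has_vector_derivative_transform)
    then show ?thesis using that by (simp add: at_within_Icc_at)
  qed
  have "F s \<le> F t"
  proof (rule DERIV_nonpos_imp_decreasing_open[OF s])
    fix r assume r: "t < r" "r < s"
    have "((\<lambda>r. D r \<bullet> D r) has_derivative (\<lambda>h. D r \<bullet> (h *\<^sub>R (A *v D r))
        + (h *\<^sub>R (A *v D r)) \<bullet> D r)) (at r)"
      using D'[OF r] unfolding has_vector_derivative_def by (intro has_derivative_inner)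
    then have "((\<lambda>r. D r \<bullet> D r) has_real_derivative 2 * (D r \<bullet> (A *v D r))) (at r)"
      by (rule has_derivative_imp_has_field_derivative) (simp add: inner_commute)
    then have "(F has_real_derivative exp (- 2 * k * r) * (2 * (D r \<bullet> (A *v D r)) - 2 * k * (D r \<bullet> D r))) (at r)"
      unfolding F_def by (auto intro!: derivative_eq_intros simp: algebra_simps)
    moreover have "D r \<bullet> (A *v D r) \<le> k * (D r \<bullet> D r)"
    proof -
      have "D r \<bullet> (A *v D r) \<le> norm (D r) * norm (A *v D r)" by (rule norm_cauchy_schwarz)
      also have "\<dots> \<le> norm (D r) * (k * norm (D r))"
        unfolding k_def by (intro mult_left_mono onorm) auto
      finally show ?thesis by (simp add: dot_square_norm power2_eq_square mult_ac)
    qed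
    ultimately show "\<exists>y. (F has_real_derivative y) (at r) \<and> y \<le> 0"
      by (intro exI conjI) (auto simp: mult_le_0_iff)
  next
    show "continuous_on {t..s} F"
      unfolding F_def by (intro continuous_intros cD)
  qed
  moreover have "D t = 0"
    using D_int[of t] s by simp
  ultimately have "D s \<bullet> D s \<le> 0"
    by (simp add: F_def mult_le_0_iff)
  then show ?thesis by (metis inner_eq_zero_iff inner_ge_zero order_antisym)
qed

lemma trajectory_unique:
  assumes X: "is_trajectory A B t x u X" and Y: "is_trajectory A B t x u Y" and s: "t \<le> s"
  shows "X s = Y s"
proof -
  have "X s - Y s = 0"
  proof (rule linear_ode_zero[OF _ _ s, where A=A])
    show "continuous_on {t..} (\<lambda>s. X s - Y s)"
      by (intro continuous_intros trajectory_continuous[OF X] trajectory_continuous[OF Y])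
    fix s assume "t \<le> s"
    then have "set_integrable lebesgue {t..s} (\<lambda>r. A *v X r + B *v u r)"
        "X s = x + (LINT r:{t..s}|lebesgue. A *v X r + B *v u r)"
        "set_integrable lebesgue {t..s} (\<lambda>r. A *v Y r + B *v u r)"
        "Y s = x + (LINT r:{t..s}|lebesgue. A *v Y r + B *v u r)"
      using X Y by (auto simp: is_trajectory_def)
    then show "X s - Y s = (LINT r:{t..s}|lebesgue. A *v (X r - Y r))"
      using set_integral_diff(2)[of lebesgue "{t..s}" "\<lambda>r. A *v X r + B *v u r" "\<lambda>r. A *v Y r + B *v u r"]
      by (simp add: matrix_vector_mult_diff_distrib)
  qed
  then show ?thesis by simp
qed

text \<open>Because trajectories are unique, the trajectory picked by the choice operator is the explicit one at
  hand.\<close>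
lemma trajectory_eqI:
  assumes "is_trajectory A B t x u X" and "t \<le> s"
  shows "trajectory A B t x u s = X s"
  unfolding trajectory_def
  by (rule trajectory_unique[OF someI[of "is_trajectory A B t x u"] assms]) (rule assms(1))

lemma admissible_set_integrable:
  assumes u: "u \<in> admissible_controls t"
  shows "set_integrable lebesgue {t..s} u"
proof (rule set_integrable_bound)
  have "set_integrable lebesgue {t..s} (\<lambda>r. (norm (u r))\<^sup>2)"
    using u by (auto simp: admissible_controls_def intro: set_integrable_subset)
  then show "set_integrable lebesgue {t..s} (\<lambda>r. 1 + (norm (u r))\<^sup>2)"
    by (rule set_integral_add(1)[OF absolutely_integrable_continuous_real[OF continuous_on_const]])
  have "(indicator {t..s} :: real \<Rightarrow> real) \<in> borel_measurable lebesgue"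
    by (rule measurable_completion) simp
  moreover have "(\<lambda>r. indicator {t..} r *\<^sub>R u r) \<in> borel_measurable lebesgue"
    using u by (simp add: admissible_controls_def set_borel_measurable_def)
  ultimately have "(\<lambda>r. indicator {t..s} r *\<^sub>R (indicator {t..} r *\<^sub>R u r))
      \<in> borel_measurable lebesgue"
    by (rule borel_measurable_scaleR)
  also have "(\<lambda>r. indicator {t..s} r *\<^sub>R (indicator {t..} r *\<^sub>R u r))
      = (\<lambda>r. indicator {t..s} r *\<^sub>R u r)"
    by (auto simp: indicator_def)
  finally show "set_borel_measurable lebesgue {t..s} u"
    by (simp add: set_borel_measurable_def)
  have "norm (u r) \<le> 1 + (norm (u r))\<^sup>2" for r
    using zero_le_power2[of "norm (u r) - 1/2"] by (simp add: power2_eq_square algebra_simps)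
  then show "AE r in lebesgue. r \<in> {t..s} \<longrightarrow> norm (u r) \<le> norm (1 + (norm (u r))\<^sup>2)"
    by (simp add: add_nonneg_nonneg)
qed

lemma admissible_controls_add:
  assumes u: "u \<in> admissible_controls t" and v: "v \<in> admissible_controls t"
  shows "(\<lambda>s. u s + v s) \<in> admissible_controls t"
proof -
  have meas: "set_borel_measurable lebesgue {t..} (\<lambda>s. u s + v s)"
    using u v unfolding admissible_controls_def set_borel_measurable_def scaleR_add_right
    by (intro borel_measurable_add) auto
  have "set_integrable lebesgue {t..} (\<lambda>s. 2 * (norm (u s))\<^sup>2 + 2 * (norm (v s))\<^sup>2)"
    using u v by (intro set_integral_add(1) set_integrable_mult_right) (auto simp: admissible_controls_def)
  then have "set_integrable lebesgue {t..} (\<lambda>s. (norm (u s + v s))\<^sup>2)"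
  proof (rule set_integrable_bound)
    have "(\<lambda>s. (norm (indicator {t..} s *\<^sub>R (u s + v s)))\<^sup>2) \<in> borel_measurable lebesgue"
      using meas unfolding set_borel_measurable_def by measurable
    also have "(\<lambda>s. (norm (indicator {t..} s *\<^sub>R (u s + v s)))\<^sup>2)
        = (\<lambda>s. indicator {t..} s *\<^sub>R (norm (u s + v s))\<^sup>2)"
      by (auto simp: indicator_def)
    finally show "set_borel_measurable lebesgue {t..} (\<lambda>s. (norm (u s + v s))\<^sup>2)"
      by (simp add: set_borel_measurable_def)
    have "(norm (u s + v s))\<^sup>2 \<le> 2 * (norm (u s))\<^sup>2 + 2 * (norm (v s))\<^sup>2" for s
    proof -
      have "(norm (u s + v s))\<^sup>2 \<le> (norm (u s) + norm (v s))\<^sup>2"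
        by (intro power_mono norm_triangle_ineq) auto
      also have "\<dots> \<le> 2 * (norm (u s))\<^sup>2 + 2 * (norm (v s))\<^sup>2"
        using zero_le_power2[of "norm (u s) - norm (v s)"] by (simp add: power2_eq_square algebra_simps)
      finally show ?thesis .
    qed
    then show "AE s in lebesgue. s \<in> {t..} \<longrightarrow> norm ((norm (u s + v s))\<^sup>2)
        \<le> norm (2 * (norm (u s))\<^sup>2 + 2 * (norm (v s))\<^sup>2)"
      by (intro AE_I2) simp
  qed
  with meas show ?thesis by (simp add: admissible_controls_def)
qed

lemma
  assumes u: "u \<in> admissible_controls t"
  shows is_trajectory_trajectory: "is_trajectory A B t x u (trajectory A B t x u)"
    and trajectory_formula: "t \<le> s \<Longrightarrow> trajectory A B t x u s = matrix_exp ((s - t) *\<^sub>R A) *v x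
            + (LINT r:{t..s}|lebesgue. matrix_exp ((s - r) *\<^sub>R A) *v (B *v u r))"
proof -
  define X where "X s = matrix_exp ((s - t) *\<^sub>R A) *v x
            + (LINT r:{t..s}|lebesgue. matrix_exp ((s - r) *\<^sub>R A) *v (B *v u r))" for s
  have "set_integrable lebesgue {t..s} (\<lambda>r. B *v u r)" for s
    using integrable_bounded_linear[OF matrix_vector_mul_bounded_linear admissible_set_integrable[OF u, unfolded set_integrable_def]]
    by (simp add: set_integrable_def matrix_vector_mult_scaleR)
  from variation_of_constants[OF this X_def]
  have X: "is_trajectory A B t x u X"
    by (simp add: is_trajectory_def)
  show "is_trajectory A B t x u (trajectory A B t x u)"
    unfolding trajectory_def by (rule someI[of "is_trajectory A B t x u", OF X])
  show "trajectory A B t x u s = matrix_exp ((s - t) *\<^sub>R A) *v x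
            + (LINT r:{t..s}|lebesgue. matrix_exp ((s - r) *\<^sub>R A) *v (B *v u r))" if "t \<le> s"
    using trajectory_eqI[OF X that] by (simp add: X_def)
qed

section \<open>Square integrability of trajectories\<close>

text \<open>Convolving with the integrable kernel \<open>e\<^bsup>-\<mu>s\<^esup>\<close> preserves integrability:
  by Tonelli's theorem the total mass of the convolution is \<open>1/\<mu>\<close> times that of
  \<open>g\<close>.\<close>
lemma exp_convolution_set_integrable:
  fixes g :: "real \<Rightarrow> real"
  assumes g: "set_integrable lebesgue {t..} g" and g_nonneg: "\<And>r. 0 \<le> g r" and \<mu>: "0 < \<mu>"
  shows "set_integrable lebesgue {t..} (\<lambda>s. LINT r:{t..s}|lebesgue. exp (- \<mu> * (s - r)) * g r)"
proof -
  define G where "G r = indicator {t..} r * g r" for r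
  define K where "K r s = (if r \<le> s then exp (- \<mu> * (s - r)) * G r else 0)" for r s
  have G_int: "integrable lebesgue G"
    using g by (simp add: G_def[abs_def] set_integrable_def)
  then have [measurable]: "G \<in> borel_measurable lebesgue" by auto
  have id_meas [measurable]: "(\<lambda>x::real. x) \<in> lebesgue \<rightarrow>\<^sub>M borel"
    by (rule measurable_completion) simp
  have G_nonneg: "0 \<le> G r" for r
    using g_nonneg by (simp add: G_def)
  have K_eq: "K r s = G r * (indicator {r..} s *\<^sub>R exp (- \<mu> * (s - r)))" for r s
    by (simp add: K_def)
  have "integrable (lebesgue \<Otimes>\<^sub>M lebesgue) (case_prod K)"
  proof (rule lebesgue_pair.Fubini_integrable)
    have "(\<lambda>z. if fst z \<le> snd z then exp (- \<mu> * (snd z - fst z)) * G (fst z) else 0)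
        \<in> borel_measurable (lebesgue \<Otimes>\<^sub>M lebesgue)"
      by measurable
    then show "case_prod K \<in> borel_measurable (lebesgue \<Otimes>\<^sub>M lebesgue)"
      by (simp add: K_def case_prod_unfold)
    have sect: "integrable lebesgue (K r)" for r
      unfolding K_eq
      using set_integrable_exp_kernel(1)[OF \<mu>, of r] by (simp add: set_integrable_def)
    then show "AE r in lebesgue. integrable lebesgue (\<lambda>s. case_prod K (r, s))"
      by simp
    have "norm (K r s) = K r s" for r s
      using G_nonneg by (simp add: K_def)
    moreover have "(LINT s|lebesgue. K r s) = G r * (1 / \<mu>)" for r
      unfolding K_eq using set_integrable_exp_kernel(2)[OF \<mu>, of r]
      by (simp add: set_lebesgue_integral_def)
    ultimately show "integrable lebesgue (\<lambda>r. LINT s|lebesgue. norm (case_prod K (r, s)))"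
      using G_int by simp
  qed
  from lebesgue_pair.integrable_snd[OF this]
  have "integrable lebesgue (\<lambda>s. LINT r|lebesgue. K r s)" .
  also have "(\<lambda>s. LINT r|lebesgue. K r s)
      = (\<lambda>s. indicator {t..} s *\<^sub>R (LINT r:{t..s}|lebesgue. exp (- \<mu> * (s - r)) * g r))"
  proof
    fix s
    show "(LINT r|lebesgue. K r s) = indicator {t..} s *\<^sub>R (LINT r:{t..s}|lebesgue. exp (- \<mu> * (s - r)) * g r)"
    proof (cases "t \<le> s")
      case True
      then show ?thesis
        unfolding set_lebesgue_integral_def
        by (auto simp: K_def G_def indicator_def intro!: Bochner_Integration.integral_cong)
    next
      case False
      then have "K r s = 0" for r by (simp add: K_def G_def)
      then show ?thesis using False by simp
    qed
  qed
  finally show ?thesis by (simp add: set_integrable_def)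
qed

lemma exp_convolution_square_le:
  fixes g :: "real \<Rightarrow> real"
  assumes g: "set_integrable lebesgue {t..s} g" and g2: "set_integrable lebesgue {t..s} (\<lambda>r. (g r)\<^sup>2)"
    and \<mu>: "0 < \<mu>" and s: "t \<le> s"
  shows "set_integrable lebesgue {t..s} (\<lambda>r. exp (- \<mu> * (s - r)) * g r)"
    and "(LINT r:{t..s}|lebesgue. exp (- \<mu> * (s - r)) * g r)\<^sup>2
       \<le> 1 / \<mu> * (LINT r:{t..s}|lebesgue. exp (- \<mu> * (s - r)) * (g r)\<^sup>2)"
proof -
  have mult: "set_integrable lebesgue {t..s} (\<lambda>r. exp (- \<mu> * (s - r)) * h r)"
    if h: "set_integrable lebesgue {t..s} h" for h :: "real \<Rightarrow> real"
  proof (rule set_integrable_bound[OF h])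
    have "(\<lambda>r. exp (- \<mu> * (s - r))) \<in> borel_measurable lebesgue"
      by (rule measurable_completion) simp
    moreover have "(\<lambda>r. indicator {t..s} r *\<^sub>R h r) \<in> borel_measurable lebesgue"
      using h by (auto simp: set_integrable_def)
    ultimately have "(\<lambda>r. exp (- \<mu> * (s - r)) * (indicator {t..s} r *\<^sub>R h r))
        \<in> borel_measurable lebesgue"
      by (rule borel_measurable_times)
    then show "set_borel_measurable lebesgue {t..s} (\<lambda>r. exp (- \<mu> * (s - r)) * h r)"
      by (simp add: set_borel_measurable_def mult_ac)
    show "AE r in lebesgue. r \<in> {t..s} \<longrightarrow> norm (exp (- \<mu> * (s - r)) * h r) \<le> norm (h r)"
      using \<mu> by (auto simp: abs_mult intro!: mult_left_le_one_le)
  qed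
  show "set_integrable lebesgue {t..s} (\<lambda>r. exp (- \<mu> * (s - r)) * g r)"
    by (rule mult[OF g])
  have "((\<lambda>r. exp (- \<mu> * (s - r)) / \<mu>)
      has_vector_derivative exp (- \<mu> * (s - r))) (at r within {t..s})" for r
    unfolding has_real_derivative_iff_has_vector_derivative[symmetric]
    using \<mu> by (auto intro!: derivative_eq_intros)
  moreover have "continuous_on {t..s} (\<lambda>r. exp (- \<mu> * (s - r)))"
    by (intro continuous_intros)
  ultimately have "set_integrable lebesgue {t..s} (\<lambda>r. exp (- \<mu> * (s - r)))"
    and "(LINT r:{t..s}|lebesgue. exp (- \<mu> * (s - r)))
        = exp (- \<mu> * (s - s)) / \<mu> - exp (- \<mu> * (s - t)) / \<mu>"
    by (rule set_integral_FTC[OF s])+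
  moreover from this \<mu> have "(LINT r:{t..s}|lebesgue. exp (- \<mu> * (s - r))) \<le> 1 / \<mu>"
    by simp
  ultimately show "(LINT r:{t..s}|lebesgue. exp (- \<mu> * (s - r)) * g r)\<^sup>2
       \<le> 1 / \<mu> * (LINT r:{t..s}|lebesgue. exp (- \<mu> * (s - r)) * (g r)\<^sup>2)"
    using weighted_jensen[of lebesgue "\<lambda>r. indicator {t..s} r * exp (- \<mu> * (s - r))" g "1 / \<mu>"]
      mult[OF g] mult[OF g2] \<mu>
    by (simp add: set_integrable_def set_lebesgue_integral_def mult.assoc)
qed

text \<open>This is where exponential decay is used: in the variation of constants formula the free part decays
  exponentially, and the forced part is dominated by \<open>|u|\<close> convolved with
  \<open>e\<^bsup>-\<mu>s\<^esup>\<close>, whose square is by Jensen's inequality at most a constant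
  times the convolution of \<open>|u|\<^sup>2\<close> with the same kernel.\<close>
lemma trajectory_square_integrable:
  fixes A :: "real^'n^'n" and B :: "real^'m^'n"
  assumes u: "u \<in> admissible_controls t" and \<mu>: "0 < \<mu>"
    and E: "\<And>s. 0 \<le> s \<Longrightarrow> onorm ((*v) (matrix_exp (s *\<^sub>R A))) \<le> M * exp (- \<mu> * s)"
  shows "set_integrable lebesgue {t..} (\<lambda>s. (norm (trajectory A B t x u s))\<^sup>2)"
proof -
  let ?X = "trajectory A B t x u"
  define b where "b = onorm ((*v) B)"
  define g where "g r = norm (u r)" for r
  define d where "d s = (LINT r:{t..s}|lebesgue. exp (- \<mu> * (s - r)) * (g r)\<^sup>2)" for s
  have M: "0 \<le> M"
    using E[of 0] onorm_pos_le[of "(*v) (matrix_exp (0 *\<^sub>R A))"] by simp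
  have b: "0 \<le> b" "norm (B *v y) \<le> b * norm y" for y
    unfolding b_def by (auto intro: onorm onorm_pos_le)
  have Ev: "norm (matrix_exp (s *\<^sub>R A) *v y) \<le> M * exp (- \<mu> * s) * norm y" if "0 \<le> s" for s y
    using onorm[OF matrix_vector_mul_bounded_linear, of "matrix_exp (s *\<^sub>R A)" y] E[OF that]
    by (meson mult_right_mono norm_ge_zero order_trans)
  have u2: "set_integrable lebesgue {t..} (\<lambda>r. (g r)\<^sup>2)"
    using u by (simp add: admissible_controls_def g_def)
  have d_int: "set_integrable lebesgue {t..} d"
    unfolding d_def by (rule exp_convolution_set_integrable[OF u2 _ \<mu>]) simp
  have bound: "(norm (?X s))\<^sup>2 \<le> 2 * M\<^sup>2 * (norm x)\<^sup>2 * exp (- (2 * \<mu>) * (s - t))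
      + 2 * M\<^sup>2 * b\<^sup>2 / \<mu> * d s"
    if s: "t \<le> s" for s
  proof -
    define c where "c = (LINT r:{t..s}|lebesgue. exp (- \<mu> * (s - r)) * g r)"
    have g1: "set_integrable lebesgue {t..s} g"
      unfolding g_def by (rule set_integrable_norm[OF admissible_set_integrable[OF u]])
    have g2: "set_integrable lebesgue {t..s} (\<lambda>r. (g r)\<^sup>2)"
      by (rule set_integrable_subset[OF u2]) auto
    note conv = exp_convolution_square_le[OF g1 g2 \<mu> s]
    have "norm (LINT r:{t..s}|lebesgue. matrix_exp ((s - r) *\<^sub>R A) *v (B *v u r))
        \<le> (LINT r:{t..s}|lebesgue. M * b * (exp (- \<mu> * (s - r)) * g r))"
      unfolding set_lebesgue_integral_def
    proof (rule order.trans[OF integral_norm_bound], rule integral_mono')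
      show "integrable lebesgue (\<lambda>r. indicator {t..s} r *\<^sub>R (M * b * (exp (- \<mu> * (s - r)) * g r)))"
        using set_integrable_mult_right[OF conv(1), of "M * b"] by (simp add: set_integrable_def)
      fix r
      show "norm (indicator {t..s} r *\<^sub>R (matrix_exp ((s - r) *\<^sub>R A) *v (B *v u r)))
          \<le> indicator {t..s} r *\<^sub>R (M * b * (exp (- \<mu> * (s - r)) * g r))"
      proof (cases "r \<in> {t..s}")
        case True
        then have "norm (matrix_exp ((s - r) *\<^sub>R A) *v (B *v u r)) \<le> M * exp (- \<mu> * (s - r)) * norm (B *v u r)"
          by (intro Ev) auto
        also have "\<dots> \<le> M * exp (- \<mu> * (s - r)) * (b * norm (u r))"
          using M by (intro mult_left_mono b) auto
        finally show ?thesis using True by (simp add: g_def mult_ac)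
      qed simp
      show "0 \<le> indicator {t..s} r *\<^sub>R (M * b * (exp (- \<mu> * (s - r)) * g r))"
        using M b by (simp add: g_def)
    qed
    also have "\<dots> = M * b * c"
      by (simp add: c_def)
    finally have W: "norm (LINT r:{t..s}|lebesgue. matrix_exp ((s - r) *\<^sub>R A) *v (B *v u r)) \<le> M * b * c" .
    let ?a = "M * exp (- \<mu> * (s - t)) * norm x"
    have "norm (?X s) \<le> ?a + M * b * c"
      unfolding trajectory_formula[OF u s]
      using norm_triangle_ineq Ev[of "s - t" x] W s by (smt (verit))
    then have "(norm (?X s))\<^sup>2 \<le> (?a + M * b * c)\<^sup>2"
      by (intro power_mono) auto
    also have "\<dots> \<le> 2 * ?a\<^sup>2 + 2 * (M * b * c)\<^sup>2"
      using zero_le_power2[of "?a - M * b * c"] by (simp add: power2_eq_square algebra_simps)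
    also have "(M * b * c)\<^sup>2 \<le> (M * b)\<^sup>2 * (1 / \<mu> * d s)"
      unfolding power_mult_distrib[of "M * b" c]
      using conv(2) by (intro mult_left_mono) (auto simp: c_def d_def)
    also have "?a\<^sup>2 = M\<^sup>2 * (norm x)\<^sup>2 * exp (- (2 * \<mu>) * (s - t))"
      by (simp add: power_mult_distrib mult_ac flip: exp_double)
    finally show ?thesis
      by (simp add: power_mult_distrib mult_ac)
  qed
  have "set_integrable lebesgue {t..} (\<lambda>s. 2 * M\<^sup>2 * (norm x)\<^sup>2 * exp (- (2 * \<mu>) * (s - t)) + 2 * M\<^sup>2 * b\<^sup>2 / \<mu> * d s)"
    using \<mu> by (intro set_integral_add(1) set_integrable_mult_right set_integrable_exp_kernel d_int) auto
  then show ?thesis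
  proof (rule set_integrable_bound)
    have "continuous_on {t..} ?X"
      by (rule trajectory_continuous[OF is_trajectory_trajectory[OF u]])
    then show "set_borel_measurable lebesgue {t..} (\<lambda>s. (norm (?X s))\<^sup>2)"
      by (intro set_borel_measurable_continuous_lebesgue continuous_intros) auto
    show "AE s in lebesgue. s \<in> {t..} \<longrightarrow> norm ((norm (?X s))\<^sup>2)
        \<le> norm (2 * M\<^sup>2 * (norm x)\<^sup>2 * exp (- (2 * \<mu>) * (s - t))
            + 2 * M\<^sup>2 * b\<^sup>2 / \<mu> * d s)"
      using bound by (intro AE_I2) (smt (verit) atLeast_iff real_norm_def zero_le_power2)
  qed
qed

section \<open>Splitting off the linear part of the cost\<close>

lemma running_cost_split:
  "running_cost Q S q s x u = running_cost Q S (\<lambda>_. 0) s x u + 2 * (q s \<bullet> x)"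
  by (simp add: running_cost_def)

lemma quadratic_cost_bound:
  fixes Q :: "real^'n^'n" and S :: "real^'n^'m"
  shows "\<bar>running_cost Q S (\<lambda>_. 0) s x u\<bar>
      \<le> (onorm ((*v) Q) + onorm ((*v) S) + 1) * ((norm x)\<^sup>2 + (norm u)\<^sup>2)"
proof -
  let ?a = "onorm ((*v) Q)" and ?b = "onorm ((*v) S)"
  have pos: "0 \<le> ?a" "0 \<le> ?b" by (auto intro: onorm_pos_le)
  have "\<bar>(Q *v x) \<bullet> x\<bar> \<le> ?a * norm x * norm x"
    by (rule order.trans[OF Cauchy_Schwarz_ineq2]) (intro mult_right_mono onorm; simp)
  then have Q: "\<bar>(Q *v x) \<bullet> x\<bar> \<le> ?a * (norm x)\<^sup>2"
    by (simp add: power2_eq_square mult_ac)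
  have "\<bar>(S *v x) \<bullet> u\<bar> \<le> ?b * norm x * norm u"
    by (rule order.trans[OF Cauchy_Schwarz_ineq2]) (intro mult_right_mono onorm; simp)
  moreover have "2 * (norm x * norm u) \<le> (norm x)\<^sup>2 + (norm u)\<^sup>2"
    using zero_le_power2[of "norm x - norm u"] by (simp add: power2_eq_square algebra_simps)
  then have "?b * (2 * (norm x * norm u)) \<le> ?b * ((norm x)\<^sup>2 + (norm u)\<^sup>2)"
    using pos by (intro mult_left_mono)
  ultimately have S: "\<bar>2 * ((S *v x) \<bullet> u)\<bar> \<le> ?b * ((norm x)\<^sup>2 + (norm u)\<^sup>2)"
    by (simp add: abs_mult)
  have "?a * (norm x)\<^sup>2 \<le> ?a * ((norm x)\<^sup>2 + (norm u)\<^sup>2)"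
    using pos by (intro mult_left_mono) auto
  moreover have "\<bar>(norm u)\<^sup>2\<bar> \<le> (norm x)\<^sup>2 + (norm u)\<^sup>2"
    by simp
  moreover have "\<bar>running_cost Q S (\<lambda>_. 0) s x u\<bar>
      \<le> \<bar>(Q *v x) \<bullet> x\<bar> + \<bar>2 * ((S *v x) \<bullet> u)\<bar> + \<bar>(norm u)\<^sup>2\<bar>"
    unfolding running_cost_def inner_zero_left mult_zero_right add_0_right
    by (rule order.trans[OF abs_triangle_ineq add_right_mono[OF abs_triangle_ineq]])
  ultimately show ?thesis
    using Q S unfolding distrib_right mult_1 by linarith
qed

text \<open>Setting \<open>q = 0\<close> in \<^const>\<open>running_cost\<close> leaves its quadratic part, which is
  integrable up to infinity because state and control are square integrable. Homogeneity lets the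
  indicator of \<open>[t,\<infinity>)\<close> be moved into both arguments, and there measurability is
  known.\<close>
lemma quadratic_cost_set_integrable:
  fixes Q :: "real^'n^'n" and S :: "real^'n^'m"
  assumes u: "u \<in> admissible_controls t"
    and X: "continuous_on {t..} X" "set_integrable lebesgue {t..} (\<lambda>s. (norm (X s))\<^sup>2)"
  shows "set_integrable lebesgue {t..} (\<lambda>s. running_cost Q S (\<lambda>_. 0) s (X s) (u s))"
proof (rule set_integrable_bound)
  let ?K = "onorm ((*v) Q) + onorm ((*v) S) + 1"
  show "set_integrable lebesgue {t..} (\<lambda>s. ?K * ((norm (X s))\<^sup>2 + (norm (u s))\<^sup>2))"
    using u X by (intro set_integrable_mult_right set_integral_add(1)) (simp_all add: admissible_controls_def)
  have [measurable]: "(\<lambda>s. indicator {t..} s *\<^sub>R X s) \<in> borel_measurable lebesgue"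
      "(\<lambda>s. indicator {t..} s *\<^sub>R u s) \<in> borel_measurable lebesgue"
    using u set_borel_measurable_continuous_lebesgue[OF X(1)]
    by (simp_all add: admissible_controls_def set_borel_measurable_def)
  have [measurable]: "(\<lambda>s. P *v (indicator {t..} s *\<^sub>R X s))
      \<in> borel_measurable lebesgue" for P :: "real^'n^'k"
    by (rule borel_measurable_matrix_vector_mult) auto
  have "(\<lambda>s. running_cost Q S (\<lambda>_. 0) s (indicator {t..} s *\<^sub>R X s) (indicator {t..} s *\<^sub>R u s)) \<in> borel_measurable lebesgue"
    unfolding running_cost_def by measurable
  also have "(\<lambda>s. running_cost Q S (\<lambda>_. 0) s (indicator {t..} s *\<^sub>R X s) (indicator {t..} s *\<^sub>R u s))
      = (\<lambda>s. indicator {t..} s *\<^sub>R running_cost Q S (\<lambda>_. 0) s (X s) (u s))"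
    by (auto simp: indicator_def running_cost_def)
  finally show "set_borel_measurable lebesgue {t..} (\<lambda>s. running_cost Q S (\<lambda>_. 0) s (X s) (u s))"
    by (simp add: set_borel_measurable_def)
  show "AE s in lebesgue. s \<in> {t..} \<longrightarrow> norm (running_cost Q S (\<lambda>_. 0) s (X s) (u s))
      \<le> norm (?K * ((norm (X s))\<^sup>2 + (norm (u s))\<^sup>2))"
  proof (intro AE_I2 impI)
    fix s
    show "norm (running_cost Q S (\<lambda>_. 0) s (X s) (u s))
        \<le> norm (?K * ((norm (X s))\<^sup>2 + (norm (u s))\<^sup>2))"
      using quadratic_cost_bound[of Q S s "X s" "u s"] unfolding real_norm_def by linarith
  qed
qed

lemma set_integrable_inner_continuous:
  fixes q X :: "real \<Rightarrow> 'a::euclidean_space"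
  assumes q: "set_integrable lebesgue {a..b} q" and X: "continuous_on {a..b} X"
  shows "set_integrable lebesgue {a..b} (\<lambda>s. q s \<bullet> X s)"
proof -
  obtain C where C: "\<And>s. s \<in> {a..b} \<Longrightarrow> norm (X s) \<le> C"
    using compact_imp_bounded[OF compact_continuous_image[OF X compact_Icc]] unfolding bounded_iff by blast
  have "set_integrable lebesgue {a..b} (\<lambda>s. C * norm (q s))"
    by (intro set_integrable_mult_right set_integrable_norm q)
  then show ?thesis
  proof (rule set_integrable_bound)
    have "(\<lambda>s. indicator {a..b} s *\<^sub>R q s) \<in> borel_measurable lebesgue"
        "(\<lambda>s. indicator {a..b} s *\<^sub>R X s) \<in> borel_measurable lebesgue"
      using q set_borel_measurable_continuous_lebesgue[OF X]
      by (auto simp: set_integrable_def set_borel_measurable_def)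
    then have "(\<lambda>s. (indicator {a..b} s *\<^sub>R q s) \<bullet> (indicator {a..b} s *\<^sub>R X s))
        \<in> borel_measurable lebesgue"
      by (rule borel_measurable_inner)
    also have "(\<lambda>s. (indicator {a..b} s *\<^sub>R q s) \<bullet> (indicator {a..b} s *\<^sub>R X s))
        = (\<lambda>s. indicator {a..b} s *\<^sub>R (q s \<bullet> X s))"
      by (auto simp: indicator_def)
    finally show "set_borel_measurable lebesgue {a..b} (\<lambda>s. q s \<bullet> X s)"
      by (simp add: set_borel_measurable_def)
    show "AE s in lebesgue. s \<in> {a..b} \<longrightarrow> norm (q s \<bullet> X s) \<le> norm (C * norm (q s))"
    proof (intro AE_I2 impI)
      fix s assume "s \<in> {a..b}"
      then have "norm (q s) * norm (X s) \<le> norm (q s) * C"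
        by (intro mult_left_mono C) auto
      then show "norm (q s \<bullet> X s) \<le> norm (C * norm (q s))"
        using Cauchy_Schwarz_ineq2[of "q s" "X s"] by (simp add: mult.commute)
    qed
  qed
qed

text \<open>Up to an error that stays bounded in \<open>T\<close>, the cost of any admissible control is the
  contribution of the linear term alone, since the quadratic part has a finite integral over
  \<open>[t,\<infinity>)\<close>. The comparison of two controls thereby reduces to the pairing of
  \<open>q\<close> with the difference of their trajectories.\<close>
lemma cost_linear_part:
  fixes A :: "real^'n^'n" and B :: "real^'m^'n"
  assumes u: "u \<in> admissible_controls t" and \<mu>: "0 < \<mu>"
    and E: "\<And>s. 0 \<le> s \<Longrightarrow> onorm ((*v) (matrix_exp (s *\<^sub>R A))) \<le> M * exp (- \<mu> * s)"
    and q: "\<And>T. set_integrable lebesgue {t..T} q"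
  obtains C where "\<And>T. \<bar>cost A B Q S q T t x u
      - 2 * (LINT s:{t..T}|lebesgue. q s \<bullet> trajectory A B t x u s)\<bar> \<le> C"
proof
  fix T
  let ?X = "trajectory A B t x u"
  let ?L = "\<lambda>s. running_cost Q S (\<lambda>_. 0) s (?X s) (u s)"
  have cont: "continuous_on {t..} ?X"
    by (rule trajectory_continuous[OF is_trajectory_trajectory[OF u]])
  have L: "set_integrable lebesgue {t..} ?L"
    by (rule quadratic_cost_set_integrable[OF u cont trajectory_square_integrable[OF u \<mu> E]])
  have LT: "set_integrable lebesgue {t..T} ?L"
    by (rule set_integrable_subset[OF L]) auto
  have qX: "set_integrable lebesgue {t..T} (\<lambda>s. q s \<bullet> ?X s)"
    by (intro set_integrable_inner_continuous q continuous_on_subset[OF cont]) auto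
  have "cost A B Q S q T t x u = (LINT s:{t..T}|lebesgue. ?L s + 2 * (q s \<bullet> ?X s))"
    unfolding cost_def by (subst running_cost_split) simp
  also have "\<dots> = (LINT s:{t..T}|lebesgue. ?L s) + 2 * (LINT s:{t..T}|lebesgue. q s \<bullet> ?X s)"
    using set_integral_add(2)[OF LT set_integrable_mult_right[OF qX, of 2]] by simp
  finally have "cost A B Q S q T t x u - 2 * (LINT s:{t..T}|lebesgue. q s \<bullet> ?X s) = (LINT s:{t..T}|lebesgue. ?L s)"
    by simp
  also have "\<bar>\<dots>\<bar> \<le> (LINT s:{t..}|lebesgue. \<bar>?L s\<bar>)"
    unfolding set_lebesgue_integral_def real_norm_def[symmetric]
  proof (rule order.trans[OF integral_norm_bound], rule integral_mono')
    show "integrable lebesgue (\<lambda>s. indicator {t..} s *\<^sub>R norm (?L s))"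
      using set_integrable_norm[OF L] by (simp add: set_integrable_def)
  qed (auto simp: indicator_def)
  finally show "\<bar>cost A B Q S q T t x u - 2 * (LINT s:{t..T}|lebesgue. q s \<bullet> ?X s)\<bar>
      \<le> (LINT s:{t..}|lebesgue. \<bar>?L s\<bar>)" .
qed

section \<open>A slowly decaying perturbation\<close>

lemma set_integrable_inverse_square:
  "set_integrable lebesgue {t..} (\<lambda>s::real. 1 / (1 + (s - t))\<^sup>2)"
proof -
  have "((\<lambda>x::real. 1 / x\<^sup>2) has_integral 1 / (real (2 - 1) * 1 ^ (2 - 1))) {1..}"
    by (rule has_integral_inverse_power_to_inf) auto
  then have "set_integrable lebesgue {1..} (\<lambda>x::real. 1 / x\<^sup>2)"
    by (intro nonnegative_absolutely_integrable_1) (auto simp: integrable_on_def)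
  then have "integrable lebesgue (\<lambda>s. indicator {1..} ((1 - t) + 1 * s) *\<^sub>R (1 / ((1 - t) + 1 * s)\<^sup>2))"
    unfolding set_integrable_def by (rule lebesgue_integrable_real_affine) simp
  also have "(\<lambda>s. indicator {1..} ((1 - t) + 1 * s) *\<^sub>R (1 / ((1 - t) + 1 * s)\<^sup>2))
      = (\<lambda>s. indicator {t..} s *\<^sub>R (1 / (1 + (s - t))\<^sup>2))"
    by (auto simp: indicator_def algebra_simps)
  finally show ?thesis by (simp add: set_integrable_def)
qed

text \<open>The direction \<open>\<theta>\<close> need not be differentiable, but its average over \<open>[s, s +
  h]\<close> is, with derivative \<open>(\<theta>(s + h) - \<theta>(s)) / h\<close> of norm at most
  \<open>2/h\<close>. Uniform continuity provides one \<open>h\<close> for which the average stays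
  within distance \<open>1/2\<close> of \<open>\<theta>\<close> at all times, hence has inner
  product at least \<open>1/2\<close> with it.\<close>
lemma smoothed_direction:
  fixes \<theta> :: "real \<Rightarrow> 'a::euclidean_space"
  assumes uc: "uniformly_continuous_on {t..} \<theta>" and unit: "\<And>s. t \<le> s \<Longrightarrow> norm (\<theta> s) = 1"
  obtains \<psi> \<psi>' C where
    "\<And>s. t \<le> s \<Longrightarrow> (\<psi> has_vector_derivative \<psi>' s) (at s within {t..})"
    "continuous_on {t..} \<psi>'"
    "\<And>s. t \<le> s \<Longrightarrow> norm (\<psi> s) \<le> 2"
    "\<And>s. t \<le> s \<Longrightarrow> norm (\<psi>' s) \<le> C"
    "\<And>s. t \<le> s \<Longrightarrow> 1/2 \<le> \<theta> s \<bullet> \<psi> s"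
proof -
  obtain d where d: "0 < d" "\<And>r s. t \<le> r \<Longrightarrow> t
      \<le> s \<Longrightarrow> dist r s < d \<Longrightarrow> dist (\<theta> r) (\<theta> s) < 1/2"
    using uc[unfolded uniformly_continuous_on_def, rule_format, of "1/2"] by (metis atLeast_iff half_gt_zero_iff zero_less_one)
  define h where "h = d / 2"
  have h: "0 < h" "h < d" using d(1) by (auto simp: h_def)
  have cont: "continuous_on {t..} \<theta>"
    by (rule uniformly_continuous_imp_continuous[OF uc])
  have cont': "continuous_on S \<theta>" if "S \<subseteq> {t..}" for S
    by (rule continuous_on_subset[OF cont that])
  define F where "F s = integral {t..s} \<theta>" for s
  have F: "(F has_vector_derivative \<theta> s) (at s within {t..})" if s: "t \<le> s" for s
  proof -
    have "(F has_vector_derivative \<theta> s) (at s within {t..s+1})"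
      unfolding F_def using s by (intro integral_has_vector_derivative cont') auto
    moreover have "at s within {t..s+1} = at s within {t..}"
      by (rule at_within_nhd[of _ "{..<s+1}"]) auto
    ultimately show ?thesis by simp
  qed
  define \<psi> where "\<psi> s = (1 / h) *\<^sub>R (F (s + h) - F s)" for s
  define \<psi>' where "\<psi>' s = (1 / h) *\<^sub>R (\<theta> (s + h) - \<theta> s)" for s
  have close: "norm (\<psi> s - \<theta> s) \<le> 1/2" if s: "t \<le> s" for s
  proof -
    have int: "\<theta> integrable_on {t..s+h}" "\<theta> integrable_on {s..s+h}"
      using s by (auto intro!: integrable_continuous_interval cont')
    have "F s + integral {s..s+h} \<theta> = F (s + h)"
      unfolding F_def using s h by (intro Henstock_Kurzweil_Integration.integral_combine int) auto
    then have "F (s + h) - F s = integral {s..s+h} \<theta>"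
      by (metis add_diff_cancel_left')
    moreover have "integral {s..s+h} (\<lambda>r. \<theta> r - \<theta> s)
        = integral {s..s+h} \<theta> - h *\<^sub>R \<theta> s"
      using h by (subst Henstock_Kurzweil_Integration.integral_diff[OF int(2)]) auto
    ultimately have eq: "\<psi> s - \<theta> s = (1 / h) *\<^sub>R integral {s..s+h} (\<lambda>r. \<theta> r - \<theta> s)"
      using h by (simp add: \<psi>_def scaleR_diff_right)
    have "norm (integral {s..s+h} (\<lambda>r. \<theta> r - \<theta> s)) \<le> 1/2 * (s + h - s)"
    proof (rule integral_bound)
      show "continuous_on {s..s+h} (\<lambda>r. \<theta> r - \<theta> s)"
        using s by (intro continuous_intros cont') auto
      show "norm (\<theta> r - \<theta> s) \<le> 1/2" if "r \<in> {s..s+h}" for r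
        using d(2)[of r s] that s h by (auto simp: dist_norm)
    qed (use h in auto)
    then show ?thesis
      unfolding eq using h by (simp add: field_simps)
  qed
  show ?thesis
  proof
    fix s assume s: "t \<le> s"
    have "((\<lambda>s. s + h) has_vector_derivative 1) (at s within {t..})"
      by (auto intro!: derivative_eq_intros)
    moreover have "(F has_vector_derivative \<theta> (s + h)) (at (s + h) within (\<lambda>s. s + h) ` {t..})"
      using F[of "s + h"] s h by (auto intro: has_vector_derivative_within_subset)
    ultimately have "((F \<circ> (\<lambda>s. s + h))
        has_vector_derivative 1 *\<^sub>R \<theta> (s + h)) (at s within {t..})"
      by (rule vector_diff_chain_within)
    then have "((\<lambda>s. F (s + h)) has_vector_derivative \<theta> (s + h)) (at s within {t..})"
      by (simp add: o_def)
    from has_vector_derivative_diff[OF this F[OF s]]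
    show "(\<psi> has_vector_derivative \<psi>' s) (at s within {t..})"
      unfolding \<psi>_def[abs_def] \<psi>'_def
      by (rule bounded_linear.has_vector_derivative[OF bounded_linear_scaleR_right])
    have "norm (\<psi> s) \<le> norm (\<theta> s) + norm (\<psi> s - \<theta> s)"
      by (rule norm_triangle_sub)
    then show "norm (\<psi> s) \<le> 2"
      using close[OF s] unit[OF s] by simp
    have "norm (\<theta> (s + h) - \<theta> s) \<le> 2"
      using norm_triangle_ineq4[of "\<theta> (s + h)" "\<theta> s"] unit[of s] unit[of "s + h"] s h by simp
    then show "norm (\<psi>' s) \<le> 2 / h"
      using h by (simp add: \<psi>'_def divide_right_mono)
    have "\<bar>\<theta> s \<bullet> (\<psi> s - \<theta> s)\<bar> \<le> 1/2"
      using Cauchy_Schwarz_ineq2[of "\<theta> s" "\<psi> s - \<theta> s"] close[OF s] unit[OF s] by simp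
    moreover have "\<theta> s \<bullet> \<theta> s = 1"
      using unit[OF s] by (simp add: dot_square_norm)
    ultimately show "1/2 \<le> \<theta> s \<bullet> \<psi> s"
      unfolding abs_le_iff inner_diff_right by linarith
  next
    have "continuous_on {t..} (\<lambda>s. \<theta> (s + h))"
      using h by (intro continuous_on_compose2[OF cont]) (auto intro!: continuous_intros)
    then show "continuous_on {t..} \<psi>'"
      unfolding \<psi>'_def[abs_def] by (intro continuous_intros cont)
  qed
qed

text \<open>With \<open>B = I\<close> every continuously differentiable curve \<open>Y\<close> that starts at
  \<open>0\<close> is a trajectory, namely for the control \<open>v = Y' - A Y\<close>. The choice
  \<open>Y = - \<phi> \<psi>\<close> with \<open>\<psi>\<close> the smoothed direction and
  \<open>\<phi>(s) = r / (1 + r)\<^sup>2\<close>, \<open>r = s - t\<close>, points against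
  \<open>\<theta>\<close>. The profile \<open>\<phi>\<close> vanishes at \<open>t\<close>, and
  \<open>\<phi>\<close> and \<open>\<phi>'\<close> are bounded by \<open>1 / (1 + r)\<close>, so
  \<open>v\<close> is square integrable; yet \<open>\<phi>\<close> decays no faster than
  \<open>1/s\<close>, which is the slow decay that the average of \<open>|q|\<close> can overcome.\<close>
lemma perturbation_opposing_direction:
  fixes A :: "real^'n^'n" and \<theta> :: "real \<Rightarrow> real^'n"
  assumes uc: "uniformly_continuous_on {t..} \<theta>" and unit: "\<And>s. t \<le> s \<Longrightarrow> norm (\<theta> s) = 1"
  obtains v Y where "v \<in> admissible_controls t" "is_trajectory A (mat 1) t 0 v Y"
    "\<And>s. t \<le> s \<Longrightarrow> (s - t) / (1 + (s - t))\<^sup>2 \<le> - 2 * (\<theta> s \<bullet> Y s)"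
proof -
  obtain \<psi> \<psi>' C where \<psi>: 
    "\<And>s. t \<le> s \<Longrightarrow> (\<psi> has_vector_derivative \<psi>' s) (at s within {t..})"
    "continuous_on {t..} \<psi>'"
    "\<And>s. t \<le> s \<Longrightarrow> norm (\<psi> s) \<le> 2"
    "\<And>s. t \<le> s \<Longrightarrow> norm (\<psi>' s) \<le> C"
    "\<And>s. t \<le> s \<Longrightarrow> 1/2 \<le> \<theta> s \<bullet> \<psi> s"
    using smoothed_direction[OF assms] by blast
  define \<phi> where "\<phi> s = (s - t) / (1 + (s - t))\<^sup>2" for s
  define \<phi>' where "\<phi>' s = (1 - (s - t)) / (1 + (s - t)) ^ 3" for s
  have \<phi>_deriv: "(\<phi> has_real_derivative \<phi>' s) (at s within {t..})" if s: "t \<le> s" for s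
  proof -
    have nz: "1 + (s - t) \<noteq> 0" using s by simp
    have "(\<phi> has_real_derivative (1 * (1 + (s - t))\<^sup>2 - (s - t) * (2 * (1 + (s - t)))) / ((1
        + (s - t))\<^sup>2 * (1 + (s - t))\<^sup>2)) (at s within {t..})"
      unfolding \<phi>_def[abs_def] using nz by (auto intro!: derivative_eq_intros)
    also have "(1 * (1 + (s - t))\<^sup>2 - (s - t) * (2 * (1 + (s - t)))) / ((1 + (s - t))\<^sup>2 * (1
        + (s - t))\<^sup>2) = \<phi>' s"
    proof -
      have "(1 * r\<^sup>2 - (r - 1) * (2 * r)) / (r\<^sup>2 * r\<^sup>2)
          = (1 - (r - 1)) / r ^ 3" if "r \<noteq> 0" for r :: real
        using that by (simp add: field_simps power2_eq_square power3_eq_cube)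
      from this[OF nz] show ?thesis by (simp add: \<phi>'_def)
    qed
    finally show ?thesis .
  qed
  define Y where "Y s = - (\<phi> s *\<^sub>R \<psi> s)" for s
  define Y' where "Y' s = - (\<phi> s *\<^sub>R \<psi>' s + \<phi>' s *\<^sub>R \<psi> s)" for s
  define v where "v s = Y' s - A *v Y s" for s
  have Y_deriv: "(Y has_vector_derivative Y' s) (at s within {t..})" if s: "t \<le> s" for s
    unfolding Y_def[abs_def] Y'_def
    by (intro has_vector_derivative_minus has_vector_derivative_scaleR \<phi>_deriv \<psi> s)
  have cont_\<psi>: "continuous_on {t..} \<psi>"
    using \<psi>(1) by (auto intro: continuous_on_vector_derivative)
  have cont_Y: "continuous_on {t..} Y"
    using Y_deriv by (auto intro: continuous_on_vector_derivative)
  have cont_Y': "continuous_on {t..} Y'"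
    unfolding Y'_def[abs_def] \<phi>_def \<phi>'_def
    by (intro continuous_intros cont_\<psi> \<psi>) auto
  have cont_v: "continuous_on {t..} v"
    unfolding v_def[abs_def]
    by (intro continuous_intros cont_Y' continuous_on_compose2[OF matrix_vector_mult_linear_continuous_on cont_Y, where t=UNIV]) auto
  have v_bound: "norm (v s) \<le> (\<bar>C\<bar> + 2 + onorm ((*v) A) * 2) / (1 + (s - t))" if s: "t \<le> s" for s
  proof -
    let ?r = "1 + (s - t)" and ?k = "onorm ((*v) A)"
    have r: "1 \<le> ?r" using s by simp
    have \<phi>: "\<bar>\<phi> s\<bar> \<le> 1 / ?r"
      using s by (simp add: \<phi>_def divide_le_eq power2_eq_square)
    have "\<bar>\<phi>' s\<bar> \<le> ?r / ?r ^ 3"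
      unfolding \<phi>'_def abs_divide using s r by (intro frac_le) auto
    also have "\<dots> \<le> 1 / ?r"
      using r mult_left_mono[OF r, of ?r] by (simp add: power3_eq_cube divide_simps)
    finally have \<phi>': "\<bar>\<phi>' s\<bar> \<le> 1 / ?r" .
    have "norm (\<phi> s *\<^sub>R \<psi>' s) \<le> 1 / ?r * \<bar>C\<bar>"
      unfolding norm_scaleR using \<phi> \<psi>(4)[OF s] r by (intro mult_mono) auto
    moreover have "norm (\<phi>' s *\<^sub>R \<psi> s) \<le> 1 / ?r * 2"
      unfolding norm_scaleR using \<phi>' \<psi>(3)[OF s] r by (intro mult_mono) auto
    ultimately have Y': "norm (Y' s) \<le> 1 / ?r * \<bar>C\<bar> + 1 / ?r * 2"
      unfolding Y'_def norm_minus_cancel by (intro order.trans[OF norm_triangle_ineq] add_mono)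
    have "norm (Y s) \<le> 1 / ?r * 2"
      unfolding Y_def norm_minus_cancel norm_scaleR using \<phi> \<psi>(3)[OF s] r by (intro mult_mono) auto
    then have "norm (A *v Y s) \<le> ?k * (1 / ?r * 2)"
      by (intro order.trans[OF onorm[OF matrix_vector_mul_bounded_linear]] mult_left_mono onorm_pos_le) auto
    with Y' have "norm (v s) \<le> (1 / ?r * \<bar>C\<bar> + 1 / ?r * 2) + ?k * (1 / ?r * 2)"
      unfolding v_def by (intro order.trans[OF norm_triangle_ineq4] add_mono)
    also have "\<dots> = (\<bar>C\<bar> + 2 + ?k * 2) / ?r"
      by (simp add: add_divide_distrib)
    finally show ?thesis .
  qed
  show ?thesis
  proof
    let ?K = "\<bar>C\<bar> + 2 + onorm ((*v) A) * 2"
    have "set_integrable lebesgue {t..} (\<lambda>s. ?K\<^sup>2 * (1 / (1 + (s - t))\<^sup>2))"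
      by (rule set_integrable_mult_right) (rule set_integrable_inverse_square)
    then have "set_integrable lebesgue {t..} (\<lambda>s. (norm (v s))\<^sup>2)"
    proof (rule set_integrable_bound)
      show "set_borel_measurable lebesgue {t..} (\<lambda>s. (norm (v s))\<^sup>2)"
        by (intro set_borel_measurable_continuous_lebesgue continuous_intros cont_v) auto
      show "AE s in lebesgue. s \<in> {t..} \<longrightarrow> norm ((norm (v s))\<^sup>2)
          \<le> norm (?K\<^sup>2 * (1 / (1 + (s - t))\<^sup>2))"
        using power_mono[OF v_bound, of _ 2] by (intro AE_I2) (simp add: power_divide)
    qed
    then show "v \<in> admissible_controls t"
      by (simp add: admissible_controls_def set_borel_measurable_continuous_lebesgue cont_v)
    show "is_trajectory A (mat 1) t 0 v Y"
      unfolding is_trajectory_def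
    proof (intro allI impI)
      fix s assume s: "t \<le> s"
      have *: "A *v Y r + mat 1 *v v r = Y' r" for r
        by (simp add: v_def)
      have d: "(Y has_vector_derivative Y' r) (at r within {t..s})" if "r \<in> {t..s}" for r
        using Y_deriv[of r] that by (auto intro: has_vector_derivative_within_subset)
      have c: "continuous_on {t..s} Y'"
        by (rule continuous_on_subset[OF cont_Y']) auto
      have "Y t = 0" by (simp add: Y_def \<phi>_def)
      with set_integral_FTC[OF s d c]
      show "set_integrable lebesgue {t..s} (\<lambda>r. A *v Y r + mat 1 *v v r) \<and>
          Y s = 0 + (LINT r:{t..s}|lebesgue. A *v Y r + mat 1 *v v r)"
        unfolding * by simp
    qed
    fix s assume s: "t \<le> s"
    have "0 \<le> \<phi> s" using s by (simp add: \<phi>_def)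
    from mult_left_mono[OF \<psi>(5)[OF s] this]
    show "(s - t) / (1 + (s - t))\<^sup>2 \<le> - 2 * (\<theta> s \<bullet> Y s)"
      by (simp add: Y_def flip: \<phi>_def)
  qed
qed

section \<open>Divergence of the cost difference\<close>

text \<open>On \<open>[t + 1, T]\<close> the elapsed time \<open>r = s - t\<close> lies between \<open>1\<close> and
  \<open>T\<close>, so that \<open>r / (1 + r)\<^sup>2 \<ge> r / (2 r)\<^sup>2 = 1 / (4 r) \<ge> 1 / (4
  T)\<close>.\<close>
lemma weighted_integral_ge_average:
  fixes w :: "real \<Rightarrow> real"
  assumes t: "0 \<le> t" and T: "t + 1 \<le> T" and w: "\<And>s. 0 \<le> w s"
    and int: "set_integrable lebesgue {0..T} w"
    and int_w: "set_integrable lebesgue {t..T} (\<lambda>s. (s - t) / (1 + (s - t))\<^sup>2 * w s)"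
  shows "1 / (4 * T) * ((LINT s:{0..T}|lebesgue. w s) - (LINT s:{0..t+1}|lebesgue. w s))
      \<le> (LINT s:{t..T}|lebesgue. (s - t) / (1 + (s - t))\<^sup>2 * w s)"
proof -
  have int1: "set_integrable lebesgue {0..t+1} w"
    using T by (intro set_integrable_subset[OF int]) auto
  let ?d = "\<lambda>s. 1 / (4 * T) * (indicator {0..T} s *\<^sub>R w s - indicator {0..t+1} s *\<^sub>R w s)"
  have "1 / (4 * T) * ((LINT s:{0..T}|lebesgue. w s) - (LINT s:{0..t+1}|lebesgue. w s)) = (LINT s|lebesgue. ?d s)"
    using int int1 unfolding set_integrable_def set_lebesgue_integral_def by simp
  also have "\<dots> \<le> (LINT s:{t..T}|lebesgue. (s - t) / (1 + (s - t))\<^sup>2 * w s)"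
    unfolding set_lebesgue_integral_def
  proof (rule integral_mono)
    show "integrable lebesgue ?d"
      using int int1 unfolding set_integrable_def by simp
    show "integrable lebesgue (\<lambda>s. indicator {t..T} s *\<^sub>R ((s - t) / (1 + (s - t))\<^sup>2 * w s))"
      using int_w unfolding set_integrable_def .
    fix s
    show "?d s \<le> indicator {t..T} s *\<^sub>R ((s - t) / (1 + (s - t))\<^sup>2 * w s)"
    proof (cases "s \<in> {t+1..T} \<and> t + 1 < s")
      case True
      define r where "r = s - t"
      have r: "1 \<le> r" "r \<le> T" using True t by (auto simp: r_def)
      have "1 / (4 * T) \<le> 1 / (4 * r)"
        using r by (intro divide_left_mono) auto
      also have "\<dots> \<le> r / (1 + r)\<^sup>2"
      proof -
        have "(1 + r)\<^sup>2 \<le> (2 * r)\<^sup>2" using r by (intro power_mono) auto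
        then show ?thesis using r by (simp add: divide_simps power2_eq_square)
      qed
      finally have "1 / (4 * T) * w s \<le> r / (1 + r)\<^sup>2 * w s"
        by (rule mult_right_mono) (rule w)
      then show ?thesis using True t by (simp add: r_def)
    next
      case False
      then have "?d s = 0"
        using T t by (auto simp: indicator_def)
      moreover have "0 \<le> indicator {t..T} s *\<^sub>R ((s - t) / (1 + (s - t))\<^sup>2 * w s)"
        using w by (auto simp: indicator_def)
      ultimately show ?thesis by linarith
    qed
  qed
  finally show ?thesis .
qed

theorem theorem5p5:
  fixes A Q S :: "real^'n^'n"
    and q \<theta> :: "real \<Rightarrow> real^'n"
    and t M \<mu> :: real
    and x :: "real^'n"
  assumes "0 \<le> t"
    and "transpose Q = Q"
    and "stable_matrix A"
    and "1 \<le> M" and "0 < \<mu>"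
    and "\<And>s. 0 \<le> s \<Longrightarrow> onorm ((*v) (matrix_exp (s *\<^sub>R A))) \<le> M * exp (- \<mu> * s)"
    and "pos_semidef (Q - transpose S ** S)"
    and "\<And>T. 0 < T \<Longrightarrow> set_integrable lebesgue {0..T} q"
    and "\<not> set_integrable lebesgue {0..} q"
    and "\<And>s. t \<le> s \<Longrightarrow> norm (\<theta> s) = 1"
    and "\<And>s. t \<le> s \<Longrightarrow> q s = norm (q s) *\<^sub>R \<theta> s"
    and "uniformly_continuous_on {t..} \<theta>"
    and "Liminf at_top (\<lambda>T. ereal (1 / T * (LINT s:{0..T}|lebesgue. norm (q s)))) = \<infinity>"
  shows "\<not> (\<exists>ustar. overtaking_optimal A (mat 1) Q S q t x ustar)"
proof
  assume "\<exists>ustar. overtaking_optimal A (mat 1) Q S q t x ustar"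
  then obtain ustar where ustar: "ustar \<in> admissible_controls t"
    and opt: "\<And>u. u \<in> admissible_controls t \<Longrightarrow>
       Limsup at_top (\<lambda>T. ereal (cost A (mat 1) Q S q T t x ustar - cost A (mat 1) Q S q T t x u)) \<le> 0"
    by (auto simp: overtaking_optimal_def)
  obtain v Y where v: "v \<in> admissible_controls t" and Y: "is_trajectory A (mat 1) t 0 v Y"
    and Y\<theta>: "\<And>s. t \<le> s \<Longrightarrow> (s - t) / (1 + (s - t))\<^sup>2
        \<le> - 2 * (\<theta> s \<bullet> Y s)"
    using perturbation_opposing_direction[OF assms(12,10)] by blast
  define u where "u s = ustar s + v s" for s
  have u: "u \<in> admissible_controls t"
    unfolding u_def[abs_def] by (rule admissible_controls_add[OF ustar v])
  let ?X = "trajectory A (mat 1) t x"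
  let ?J = "\<lambda>u T. cost A (mat 1) Q S q T t x u"
  have Xu: "?X u s = ?X ustar s + Y s" if "t \<le> s" for s
  proof (rule trajectory_eqI[OF _ that])
    show "is_trajectory A (mat 1) t x u (\<lambda>s. ?X ustar s + Y s)"
      using is_trajectory_add[OF is_trajectory_trajectory[OF ustar] Y] by (simp add: u_def[abs_def])
  qed
  have q_int: "set_integrable lebesgue {0..T} q" for T
    using set_integrable_subset[OF assms(8)[of "max 1 T"], of "{0..T}"] by auto
  have qt_int: "set_integrable lebesgue {t..T} q" for T
    by (rule set_integrable_subset[OF q_int[of T]]) (use assms(1) in auto)
  obtain C1 where C1: "\<And>T. \<bar>?J ustar T - 2 * (LINT s:{t..T}|lebesgue. q s \<bullet> ?X ustar s)\<bar> \<le> C1"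
    using cost_linear_part[OF ustar assms(5,6) qt_int] by blast
  obtain C2 where C2: "\<And>T. \<bar>?J u T - 2 * (LINT s:{t..T}|lebesgue. q s \<bullet> ?X u s)\<bar> \<le> C2"
    using cost_linear_part[OF u assms(5,6) qt_int] by blast
  define c where "c = (LINT s:{0..t+1}|lebesgue. norm (q s))"
  have c: "0 \<le> c"
    unfolding c_def set_lebesgue_integral_def by simp
  have lower: "1 / 4 * (1 / T * (LINT s:{0..T}|lebesgue. norm (q s))) - c - C1 - C2 \<le> ?J ustar T - ?J u T"
    if T: "t + 1 \<le> T" for T
  proof -
    \<comment> \<open>the cost difference is the pairing of \<open>q\<close> with \<open>-2 Y\<close>, up to the bounded errors\<close>
    have inner_int: "set_integrable lebesgue {t..T} (\<lambda>s. q s \<bullet> Z s)" if "is_trajectory A (mat 1) t y w Z" for y w Z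
      using trajectory_continuous[OF that]
      by (intro set_integrable_inner_continuous qt_int) (auto intro: continuous_on_subset)
    note qX = inner_int[OF is_trajectory_trajectory[OF ustar]] and qY = inner_int[OF Y]
    have "(LINT s:{t..T}|lebesgue. q s \<bullet> ?X u s)
        = (LINT s:{t..T}|lebesgue. q s \<bullet> ?X ustar s + q s \<bullet> Y s)"
      by (intro set_lebesgue_integral_cong) (auto simp: Xu inner_add_right)
    also have "\<dots> = (LINT s:{t..T}|lebesgue. q s \<bullet> ?X ustar s) + (LINT s:{t..T}|lebesgue. q s \<bullet> Y s)"
      by (rule set_integral_add(2)[OF qX qY])
    finally have diff: "- 2 * (LINT s:{t..T}|lebesgue. q s \<bullet> Y s) - C1 - C2 \<le> ?J ustar T - ?J u T"
      using C1[of T] C2[of T] by (simp only: abs_le_iff) argo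
    let ?\<phi> = "\<lambda>s. (s - t) / (1 + (s - t))\<^sup>2"
    have norm_int: "set_integrable lebesgue {t..T} (\<lambda>s. norm (q s))"
      by (rule set_integrable_norm[OF qt_int])
    have "continuous_on {t..T} ?\<phi>"
      by (intro continuous_intros) auto
    from set_integrable_inner_continuous[OF norm_int this]
    have \<phi>q_int: "set_integrable lebesgue {t..T} (\<lambda>s. ?\<phi> s * norm (q s))"
      by (simp add: mult.commute)
    have "1 / (4 * T) * ((LINT s:{0..T}|lebesgue. norm (q s)) - c) \<le> (LINT s:{t..T}|lebesgue. ?\<phi> s * norm (q s))"
      unfolding c_def
      by (rule weighted_integral_ge_average[OF assms(1) T _ set_integrable_norm[OF q_int] \<phi>q_int]) simp
    also have "\<dots> \<le> (LINT s:{t..T}|lebesgue. - 2 * (q s \<bullet> Y s))"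
    proof (rule set_integral_mono[OF \<phi>q_int])
      show "set_integrable lebesgue {t..T} (\<lambda>s. - 2 * (q s \<bullet> Y s))"
        by (rule set_integrable_mult_right) (rule qY)
      fix s assume "s \<in> {t..T}"
      then have s: "t \<le> s" by simp
      have "q s \<bullet> Y s = norm (q s) * (\<theta> s \<bullet> Y s)"
        by (subst assms(11)[OF s]) simp
      then show "?\<phi> s * norm (q s) \<le> - 2 * (q s \<bullet> Y s)"
        using mult_right_mono[OF Y\<theta>[OF s] norm_ge_zero[of "q s"]] by (simp add: mult_ac)
    qed
    also have "\<dots> = - 2 * (LINT s:{t..T}|lebesgue. q s \<bullet> Y s)"
      by (rule set_integral_mult_right)
    finally have "1 / (4 * T) * (LINT s:{0..T}|lebesgue. norm (q s)) - 1 / (4 * T) * c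
        \<le> - 2 * (LINT s:{t..T}|lebesgue. q s \<bullet> Y s)"
      by (simp add: right_diff_distrib)
    moreover have "1 / (4 * T) * c \<le> c"
      using T assms(1) c by (intro mult_left_le_one_le) auto
    ultimately show ?thesis
      using diff by simp
  qed
  \<comment> \<open>the level of the average of \<open>|q|\<close> at which the lower bound exceeds \<open>1\<close>\<close>
  define K where "K = 4 * (c + C1 + C2 + 1)"
  have "eventually (\<lambda>T. ereal K < ereal (1 / T * (LINT s:{0..T}|lebesgue. norm (q s)))) at_top"
    using assms(13) by (intro less_LiminfD) simp
  moreover have "eventually (\<lambda>T. t + 1 \<le> T) at_top"
    by (rule eventually_ge_at_top)
  ultimately have "eventually (\<lambda>T. 1 \<le> ?J ustar T - ?J u T) at_top"
  proof eventually_elim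
    case (elim T)
    with lower[of T] show ?case by (simp add: K_def)
  qed
  moreover have "eventually (\<lambda>T. ereal (?J ustar T - ?J u T) < 1) at_top"
    using opt[OF u] by (intro Limsup_lessD) (auto intro: le_less_trans)
  ultimately have "eventually (\<lambda>T::real. False) at_top"
    by eventually_elim simp
  then show False by simp
qed

end
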